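(* Let $\{Z_t\}_{t\in\mathbb Z}$ be a stationary real-valued time series which is 2-mixing with size $\mathfrak v$, with marginal density $f$. Suppose: (i) $f$ is uniformly bounded; (ii) with $f^{(t,\tau)}$ the joint density of $(Z_t,Z_\tau)$ and $F^{(t,\tau)}(x,y):=f^{(t,\tau)}(x,y)-f(x)f(y)$ for $t\neq\tau$, the norms $\|F^{(0,t)}\|_{p_F}$ are bounded uniformly in $t$ for some $p_F>2$, and $q_F:=1-2/p_F\in(0,1)$; (iii) $K:\mathbb R\to\mathbb R$ is a univariate kernel of order $r$ which is uniformly bounded with $\|K\|_1<\infty$ and $\|K\|_2<\infty$. Let $\hat f(z)=\frac1T\sum_{t=1}^T K_b(Z_t-z)$. Assume in addition that $f\in\mathfrak G^1_{s,\triangle}$ for some $\triangle,s>0$, and let $\rho=r\wedge s$. Then for all $z\in\mathbb R$, $$\mathbb E|\hat f(z)-f(z)|^2=O\Bigl(b^{2\rho}+b^{-1}\,T^{-1}+b^{-2-q_F(1-[\mathfrak v\vee1])}\,T^{-[\mathfrak v\wedge1]}\Bigr),\qquad T\to\infty.$$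
   Context: $\wedge$ is minimum, $\vee$ is maximum. $b=b_T>0$ is a bandwidth and $K_b(z)=b^{-1}K(z/b)$. $\|g\|_p=(\int|g|^p)^{1/p}$. All densities mentioned are assumed to exist. 2-mixing: $\{Z_t\}$ is 2-mixing with size $\mathfrak v$ if there is $C<\infty$ such that for all $t\ne\tau$, $\sup_{A\in\sigma(Z_t),B\in\sigma(Z_\tau)}|P(A\cap B)-P(A)P(B)|\le C|t-\tau|^{-\mathfrak v}$. Kernel of order $r$ (univariate): $K$ is an even function with $\int K(u)\,du=1$, $\int u^iK(u)\,du=0$ for $i=1,\dots,r-1$, and $\int|u|^rK(u)\,du=S_K$ for a (finite) constant $S_K$. Class $\mathfrak G^d_{s,\triangle}$ ($s,\triangle>0$): functions $g:\mathbb R^d\to\mathbb R$ that are everywhere $(m-1)$-times partially differentiable, where $m$ is the integer with $m-1<s\le m$, and such that for some $\varrho>0$ and for all $x$, $\sup_{y:|y-x|<\varrho}\frac{|g(y)-g(x)-Q(y-x)|}{|y-x|^s}\le\triangle$, where $Q=0$ if $m=1$ and, for $m>1$, $Q$ is the $(m-1)$th-degree (Taylor) polynomial in $y-x$ without constant term whose coefficients are given by the partial derivatives of $g$ of orders $1$ to $m-1$ at $x$.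
   Formalization: The mixing size v = 1 is excluded: at v = 1 the stated bound is false in general, since the variance can exceed b^{-2}T^{-1} by a factor log T; all other values of v are covered. *)

theory Defs
  imports "HOL-Probability.Probability" "HOL-Library.Landau_Symbols"
begin

definition finite_Lp :: "real \<Rightarrow> ('a::euclidean_space \<Rightarrow> real) \<Rightarrow> bool" where
  "finite_Lp p g \<longleftrightarrow>
     g \<in> borel_measurable lborel \<and> integrable lborel (\<lambda>x. \<bar>g x\<bar> powr p)"

(* Only meaningful under finite_Lp p g: the Bochner integral of a non-integrable function is 0. *)
definition Lp_norm :: "real \<Rightarrow> ('a::euclidean_space \<Rightarrow> real) \<Rightarrow> real" where
  "Lp_norm p g = (\<integral>x. \<bar>g x\<bar> powr p \<partial>lborel) powr (1 / p)"

definition has_density :: "'w measure \<Rightarrow> ('w \<Rightarrow> 'a::euclidean_space) \<Rightarrow> ('a \<Rightarrow> real) \<Rightarrow> bool" where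
  "has_density M X f \<longleftrightarrow> (\<forall>x. 0 \<le> f x) \<and> distributed M lborel X (\<lambda>x. ennreal (f x))"

(* Strict stationarity: the finite-dimensional distributions are invariant under time shifts. *)
definition stationary :: "'w measure \<Rightarrow> (int \<Rightarrow> 'w \<Rightarrow> real) \<Rightarrow> bool" where
  "stationary M Z \<longleftrightarrow> (\<forall>t. Z t \<in> borel_measurable M) \<and>
     (\<forall>J h. finite J \<longrightarrow>
        distr M (PiM J (\<lambda>_. borel)) (\<lambda>\<omega>. \<lambda>t\<in>J. Z (t + h) \<omega>) =
        distr M (PiM J (\<lambda>_. borel)) (\<lambda>\<omega>. \<lambda>t\<in>J. Z t \<omega>))"

definition sigma_of :: "'w measure \<Rightarrow> ('w \<Rightarrow> real) \<Rightarrow> 'w set set" where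
  "sigma_of M X = sets (vimage_algebra (space M) X borel)"

(* The size v is a polynomial rate, and v = 1 is a genuine boundary case: the bound on the summed
   covariances then picks up a factor ln T, since the sum of h powr (- v) over h = 1..T is of order
   T powr (1 - min v 1) for v different from 1 but of order ln T for v = 1. *)
definition two_mixing :: "'w measure \<Rightarrow> (int \<Rightarrow> 'w \<Rightarrow> real) \<Rightarrow> real \<Rightarrow> bool" where
  "two_mixing M Z v \<longleftrightarrow> (\<exists>C. \<forall>t \<tau>. t \<noteq> \<tau> \<longrightarrow>
     (\<forall>A\<in>sigma_of M (Z t). \<forall>B\<in>sigma_of M (Z \<tau>).
        \<bar>measure M (A \<inter> B) - measure M A * measure M B\<bar> \<le> C * real_of_int \<bar>t - \<tau>\<bar> powr (- v)))"

(* has_bochner_integral includes integrability; the last conjunct says that the integral S_K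
   exists and is finite. *)
definition kernel_of_order :: "nat \<Rightarrow> (real \<Rightarrow> real) \<Rightarrow> bool" where
  "kernel_of_order r K \<longleftrightarrow>
     (\<forall>u. K (- u) = K u) \<and>
     has_bochner_integral lborel K 1 \<and>
     (\<forall>i. 1 \<le> i \<and> i < r \<longrightarrow> has_bochner_integral lborel (\<lambda>u. u ^ i * K u) 0) \<and>
     (\<exists>S\<^sub>K. has_bochner_integral lborel (\<lambda>u. \<bar>u\<bar> ^ r * K u) S\<^sub>K)"

(* The class G^d_{s,D} for d = 1. The sum is the Taylor polynomial Q of degree m - 1 without its
   constant term (empty for m = 1). The quotient is required for y different from x only. *)
definition smooth_class :: "real \<Rightarrow> real \<Rightarrow> (real \<Rightarrow> real) set" where
  "smooth_class s D = {g. \<exists>m::nat. real m - 1 < s \<and> s \<le> real m \<and>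
     (\<forall>k < m - 1. \<forall>x. (deriv ^^ k) g field_differentiable at x) \<and>
     (\<exists>\<rho>>0. \<forall>x y. y \<noteq> x \<and> \<bar>y - x\<bar> < \<rho> \<longrightarrow>
        \<bar>g y - g x - (\<Sum>k = 1..m - 1. (deriv ^^ k) g x / fact k * (y - x) ^ k)\<bar> / \<bar>y - x\<bar> powr s
          \<le> D)}"

definition scaled_kernel :: "(real \<Rightarrow> real) \<Rightarrow> real \<Rightarrow> real \<Rightarrow> real" where
  "scaled_kernel K b z = K (z / b) / b"

definition density_estimator ::
  "(int \<Rightarrow> 'w \<Rightarrow> real) \<Rightarrow> (real \<Rightarrow> real) \<Rightarrow> real \<Rightarrow> nat \<Rightarrow> real \<Rightarrow> 'w \<Rightarrow> real" where
  "density_estimator Z K b T z \<omega> =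
     1 / real T * (\<Sum>t = 1..T. scaled_kernel K b (Z (int t) \<omega> - z))"

end

theory Submission
  imports Defs
begin

text \<open>The mean squared error is the variance plus the squared bias, and for a fixed point z both
are bounded with constants that depend neither on the sample size T nor on the bandwidth b > 0, so
the rate holds along every bandwidth sequence.

Bias. After the substitution x = z + b u the expectation of the estimator is the integral of
f (z + b u) K u. Let \<rho> = min r s. The Taylor polynomial of f at z, truncated to degrees
below \<rho>, integrates against K to f z, because these degrees are below r and the corresponding
moments of K vanish. The remainder is of order |b u| powr \<rho> for all u, both near z (smoothness
of f) and far away (f is bounded and the truncated polynomial grows more slowly). This is
\<open>smoothing_bias_bound\<close>.

Variance. By stationarity it is at most 1 / T times the sum over all lags of a bound on the
covariances. The lag 0 contributes O(1 / b) (\<open>second_moment_bound\<close>). At a lag h \<noteq> 0 two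
bounds compete. Mixing gives b powr (- 2) * h powr (- v), since the windows are bounded by a
multiple of 1 / b (\<open>window_covariance_mixing_bound\<close>). Integrating the product of two windows against the
difference between the joint density and the product of the marginals gives b powr (q - 1) with
q = 1 - 2 / p for every h, by the bound on the p-norm of this difference
(\<open>window_covariance_density_bound\<close>).

If v < 1, summing the first bound over h \<le> T gives a sum of order b powr (- 2) * T powr (1 - v).
If v > 1 and b \<le> 1, the second bound is used up to h = b powr (- q), where it sums to O(1 / b), and the
first one beyond, where its sum is of order b powr (- 2 - q * (1 - v)); if b > 1, the sum of the
first bound over all lags is at most of this order. Dividing by T yields the two stochastic
terms of the rate (\<open>sum_two_bounds\<close>).\<close>

section \<open>Bias of kernel smoothing\<close>

lemma integral_rescaled_window:
  fixes g :: "real \<Rightarrow> real \<Rightarrow> real"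
  assumes "0 < b"
  shows "(\<integral>x. g x ((x - z) / b) \<partial>lborel) = b * (\<integral>u. g (z + b * u) u \<partial>lborel)"
  using assms by (subst lborel_integral_real_affine[where c = b and t = z]) auto

text \<open>For small |h| the discarded degrees are at least \<rho> and are absorbed by |h| powr \<rho>, together with
the Hoelder remainder. For large |h| the roles are reversed: g is bounded and the degrees that are kept
are smaller than \<rho>, so they grow no faster than |h| powr \<rho>. Truncating at \<rho> rather than at the
full degree n makes the bound hold for all h, which is what integration against a kernel without
compact support requires.\<close>
lemma taylor_remainder_powr_bound:
  fixes g :: "real \<Rightarrow> real" and c :: "nat \<Rightarrow> real"
  assumes g: "\<And>x. \<bar>g x\<bar> \<le> B" and \<rho>: "0 \<le> \<rho>" "\<rho> \<le> s" and \<delta>: "0 < \<delta>"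
    and near: "\<And>h. h \<noteq> 0 \<Longrightarrow> \<bar>h\<bar> < \<delta> \<Longrightarrow>
      \<bar>g (z + h) - g z - (\<Sum>k = 1..n. c k * h ^ k)\<bar> / \<bar>h\<bar> powr s \<le> D"
  shows "\<exists>C\<ge>0. \<forall>h. \<bar>g (z + h) - g z - (\<Sum>k \<in> {k \<in> {1..n}. real k < \<rho>}. c k * h ^ k)\<bar>
      \<le> C * \<bar>h\<bar> powr \<rho>"
proof -
  define \<delta>' where "\<delta>' = min \<delta> 1"
  define L where "L = {k \<in> {1..n}. real k < \<rho>}"
  define R where "R = {k \<in> {1..n}. \<not> real k < \<rho>}"
  \<comment> \<open>The three summands pay for the Hoelder remainder, for the discarded degrees
    near z, and for everything at distance at least \<delta>'.\<close>
  define C where "C = \<bar>D\<bar> + (\<Sum>k \<in> R. \<bar>c k\<bar>) + \<delta>' powr (- \<rho>) * (2 * B + (\<Sum>k \<in> L. \<bar>c k\<bar>))"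
  have d: "0 < \<delta>'" "\<delta>' \<le> \<delta>" "\<delta>' \<le> 1" using \<delta> by (auto simp: \<delta>'_def)
  have B: "0 \<le> B" using g[of 0] by linarith
  have nn: "0 \<le> (\<Sum>k \<in> R. \<bar>c k\<bar>)" "0 \<le> \<delta>' powr (- \<rho>) * (2 * B + (\<Sum>k \<in> L. \<bar>c k\<bar>))"
    using B by (auto intro!: sum_nonneg mult_nonneg_nonneg add_nonneg_nonneg)
  have split: "(\<Sum>k = 1..n. c k * h ^ k) = (\<Sum>k \<in> L. c k * h ^ k) + (\<Sum>k \<in> R. c k * h ^ k)" for h
    unfolding L_def R_def by (subst sum.union_disjoint[symmetric]) (auto intro!: sum.cong)
  have "\<bar>g (z + h) - g z - (\<Sum>k \<in> L. c k * h ^ k)\<bar> \<le> C * \<bar>h\<bar> powr \<rho>" for h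
  proof -
    consider "h = 0" | "h \<noteq> 0" "\<bar>h\<bar> < \<delta>'" | "\<delta>' \<le> \<bar>h\<bar>" by linarith
    then show ?thesis
    proof cases
      case 1
      have "(\<Sum>k \<in> L. c k * h ^ k) = 0" using 1 by (intro sum.neutral) (auto simp: L_def)
      then show ?thesis using 1 by simp
    next
      case 2
      have pw: "\<bar>h\<bar> powr a \<le> \<bar>h\<bar> powr \<rho>" if "\<rho> \<le> a" for a
        using that 2 d by (intro powr_mono') auto
      have "\<bar>g (z + h) - g z - (\<Sum>k = 1..n. c k * h ^ k)\<bar> \<le> D * \<bar>h\<bar> powr s"
        using near[of h] 2 d by (simp add: divide_le_eq)
      also have "\<dots> \<le> \<bar>D\<bar> * \<bar>h\<bar> powr \<rho>" using pw[OF \<rho>(2)] by (intro mult_mono) auto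
      finally have 1: "\<bar>g (z + h) - g z - (\<Sum>k = 1..n. c k * h ^ k)\<bar> \<le> \<bar>D\<bar> * \<bar>h\<bar> powr \<rho>" .
      have "\<bar>\<Sum>k \<in> R. c k * h ^ k\<bar> \<le> (\<Sum>k \<in> R. \<bar>c k\<bar> * \<bar>h\<bar> powr \<rho>)"
      proof (intro order_trans[OF sum_abs] sum_mono)
        fix k assume "k \<in> R"
        then show "\<bar>c k * h ^ k\<bar> \<le> \<bar>c k\<bar> * \<bar>h\<bar> powr \<rho>"
          using pw[of "real k"] 2 by (auto simp: R_def abs_mult power_abs powr_realpow intro!: mult_left_mono)
      qed
      also have "\<dots> = (\<Sum>k \<in> R. \<bar>c k\<bar>) * \<bar>h\<bar> powr \<rho>" by (simp add: sum_distrib_right)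
      finally have "\<bar>g (z + h) - g z - (\<Sum>k \<in> L. c k * h ^ k)\<bar>
          \<le> (\<bar>D\<bar> + (\<Sum>k \<in> R. \<bar>c k\<bar>)) * \<bar>h\<bar> powr \<rho>"
        using 1 split[of h] by (simp add: algebra_simps)
      also have "\<dots> \<le> C * \<bar>h\<bar> powr \<rho>" using nn by (intro mult_right_mono) (auto simp: C_def)
      finally show ?thesis .
    next
      case 3
      \<comment> \<open>Rescaling to q \<ge> 1 lets every exponent that occurs be raised to \<rho>.\<close>
      define q where "q = \<bar>h\<bar> / \<delta>'"
      have q: "1 \<le> q" using 3 d by (simp add: q_def)
      have 1: "\<bar>g (z + h) - g z\<bar> \<le> 2 * B * q powr \<rho>"
      proof -
        have "\<bar>g (z + h) - g z\<bar> \<le> 2 * B * 1" using g[of "z + h"] g[of z] by linarith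
        also have "\<dots> \<le> 2 * B * q powr \<rho>"
          using q \<rho> B by (intro mult_left_mono ge_one_powr_ge_zero) auto
        finally show ?thesis .
      qed
      have "\<bar>\<Sum>k \<in> L. c k * h ^ k\<bar> \<le> (\<Sum>k \<in> L. \<bar>c k\<bar> * q powr \<rho>)"
      proof (intro order_trans[OF sum_abs] sum_mono)
        fix k assume k: "k \<in> L"
        have "\<bar>h\<bar> \<le> q" using d by (simp add: q_def field_simps mult_left_le_one_le)
        then have "\<bar>h\<bar> ^ k \<le> q ^ k" by (intro power_mono) auto
        also have "\<dots> = q powr real k" using q by (simp add: powr_realpow)
        also have "\<dots> \<le> q powr \<rho>" using q k by (intro powr_mono) (auto simp: L_def)
        finally show "\<bar>c k * h ^ k\<bar> \<le> \<bar>c k\<bar> * q powr \<rho>"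
          by (auto simp: abs_mult power_abs intro!: mult_left_mono)
      qed
      also have "\<dots> = (\<Sum>k \<in> L. \<bar>c k\<bar>) * q powr \<rho>" by (simp add: sum_distrib_right)
      finally have "\<bar>g (z + h) - g z - (\<Sum>k \<in> L. c k * h ^ k)\<bar>
          \<le> (2 * B + (\<Sum>k \<in> L. \<bar>c k\<bar>)) * q powr \<rho>"
        using 1 by (simp add: algebra_simps)
      also have "\<dots> = (\<delta>' powr (- \<rho>) * (2 * B + (\<Sum>k \<in> L. \<bar>c k\<bar>))) * \<bar>h\<bar> powr \<rho>"
        using d by (simp add: q_def powr_divide powr_minus field_simps)
      also have "\<dots> \<le> C * \<bar>h\<bar> powr \<rho>" using nn by (intro mult_right_mono) (auto simp: C_def)
      finally show ?thesis .
    qed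
  qed
  moreover have "0 \<le> C" using nn by (simp add: C_def)
  ultimately show ?thesis unfolding L_def by blast
qed

text \<open>The truncated Taylor polynomial has degrees below both r and s. Its constant term reproduces f z
because K integrates to 1, the other terms vanish with the moments of K, and the remainder
C * |b u| powr \<rho> is integrable against K since |u| powr \<rho> \<le> 1 + |u| ^ r.\<close>
lemma smoothing_bias_bound:
  fixes f K :: "real \<Rightarrow> real"
  assumes K: "kernel_of_order r K" and f: "\<And>x. \<bar>f x\<bar> \<le> B" "f \<in> borel_measurable borel"
    "f \<in> smooth_class s D" and s: "0 < s"
  shows "\<exists>C\<ge>0. \<forall>b>0. \<bar>(\<integral>x. f x * scaled_kernel K b (x - z) \<partial>lborel) - f z\<bar> \<le> C * b powr min (real r) s"
proof -
  define \<rho> where "\<rho> = min (real r) s"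
  have \<rho>: "0 \<le> \<rho>" "\<rho> \<le> s" "\<rho> \<le> real r" using s by (auto simp: \<rho>_def)
  obtain m :: nat and \<delta> where \<delta>: "0 < \<delta>" and near: "\<And>x y. y \<noteq> x \<and> \<bar>y - x\<bar> < \<delta> \<Longrightarrow>
        \<bar>f y - f x - (\<Sum>k = 1..m - 1. (deriv ^^ k) f x / fact k * (y - x) ^ k)\<bar> / \<bar>y - x\<bar> powr s \<le> D"
    using f(3) unfolding smooth_class_def by blast
  define c where "c k = (deriv ^^ k) f z / fact k" for k
  define L where "L = {k \<in> {1..m - 1}. real k < \<rho>}"
  have "\<exists>C\<ge>0. \<forall>h. \<bar>f (z + h) - f z - (\<Sum>k \<in> L. c k * h ^ k)\<bar> \<le> C * \<bar>h\<bar> powr \<rho>"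
    unfolding L_def
  proof (rule taylor_remainder_powr_bound[OF f(1) \<rho>(1,2) \<delta>])
    show "\<bar>f (z + h) - f z - (\<Sum>k = 1..m - 1. c k * h ^ k)\<bar> / \<bar>h\<bar> powr s \<le> D"
      if "h \<noteq> 0" "\<bar>h\<bar> < \<delta>" for h
      using near[where x = z and y = "z + h"] that by (simp add: c_def)
  qed
  then obtain C where C: "0 \<le> C"
    "\<And>h. \<bar>f (z + h) - f z - (\<Sum>k \<in> L. c k * h ^ k)\<bar> \<le> C * \<bar>h\<bar> powr \<rho>" by blast
  have K1: "has_bochner_integral lborel K 1" using K by (simp add: kernel_of_order_def)
  have [measurable]: "K \<in> borel_measurable borel" "f \<in> borel_measurable borel"
    using K1 f(2) borel_measurable_integrable[of lborel K] by (auto simp: has_bochner_integral_iff)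
  have Kr: "integrable lborel (\<lambda>u. \<bar>u\<bar> ^ r * K u)"
    using K by (auto simp: kernel_of_order_def has_bochner_integral_iff)
  \<comment> \<open>Degrees in L lie strictly below \<rho> \<le> r, so their moments vanish.\<close>
  have moment: "has_bochner_integral lborel (\<lambda>u. u ^ k * K u) 0" if "k \<in> L" for k
    using K that \<rho> by (auto simp: kernel_of_order_def L_def)
  define S where "S = (\<integral>u. \<bar>K u\<bar> + \<bar>\<bar>u\<bar> ^ r * K u\<bar> \<partial>lborel)"
  have S: "0 \<le> S" unfolding S_def by (intro integral_nonneg_AE) auto
  have "\<bar>(\<integral>x. f x * scaled_kernel K b (x - z) \<partial>lborel) - f z\<bar> \<le> C * S * b powr \<rho>" if b: "0 < b" for b
  proof -
    define P where "P u = (\<Sum>k \<in> L. c k * (b * u) ^ k)" for u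
    have PK: "has_bochner_integral lborel (\<lambda>u. P u * K u) 0"
    proof -
      have "has_bochner_integral lborel (\<lambda>u. \<Sum>k \<in> L. (c k * b ^ k) * (u ^ k * K u)) (\<Sum>k \<in> L. (c k * b ^ k) * 0)"
        by (intro has_bochner_integral_sum has_bochner_integral_mult_right moment)
      then show ?thesis by (simp add: P_def sum_distrib_right power_mult_distrib mult.assoc mult.left_commute)
    qed
    have fK: "integrable lborel (\<lambda>u. f (z + b * u) * K u)"
    proof (rule Bochner_Integration.integrable_bound[where f = "\<lambda>u. B * K u"])
      show "AE u in lborel. norm (f (z + b * u) * K u) \<le> norm (B * K u)"
        using order_trans[OF f(1) abs_ge_self[of B]] by (auto simp: abs_mult intro!: mult_right_mono)
    qed (use K1 in \<open>auto simp: has_bochner_integral_iff\<close>)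
    define R where "R u = (f (z + b * u) - f z - P u) * K u" for u
    have R: "R u = f (z + b * u) * K u - f z * K u - P u * K u" for u
      by (simp add: R_def algebra_simps)
    have intR: "integrable lborel R" unfolding R[abs_def]
      using fK K1 PK by (auto simp: has_bochner_integral_iff)
    have "(\<integral>x. f x * scaled_kernel K b (x - z) \<partial>lborel) = (\<integral>u. f (z + b * u) * K u \<partial>lborel)"
      using integral_rescaled_window[OF b, of "\<lambda>x u. f x * (K u / b)" z] b by (simp add: scaled_kernel_def)
    also have "\<dots> - f z = integral\<^sup>L lborel R"
      unfolding R[abs_def] using fK K1 PK by (simp add: has_bochner_integral_iff)
    finally have "\<bar>(\<integral>x. f x * scaled_kernel K b (x - z) \<partial>lborel) - f z\<bar> = \<bar>integral\<^sup>L lborel R\<bar>" by simp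
    also have "\<dots> \<le> (\<integral>u. \<bar>R u\<bar> \<partial>lborel)" by (rule integral_abs_bound)
    also have "\<dots> \<le> (\<integral>u. (C * b powr \<rho>) * (\<bar>K u\<bar> + \<bar>\<bar>u\<bar> ^ r * K u\<bar>) \<partial>lborel)"
    proof (rule integral_mono)
      show "integrable lborel (\<lambda>u. (C * b powr \<rho>) * (\<bar>K u\<bar> + \<bar>\<bar>u\<bar> ^ r * K u\<bar>))"
        using K1 Kr by (auto simp: has_bochner_integral_iff)
      fix u
      have "\<bar>u\<bar> powr \<rho> \<le> 1 + \<bar>u\<bar> ^ r"
      proof (cases "\<bar>u\<bar> \<le> 1")
        case True
        then have "\<bar>u\<bar> powr \<rho> \<le> 1" using \<rho> powr_mono2[of \<rho> "\<bar>u\<bar>" 1] by simp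
        then show ?thesis by (simp add: add_increasing2)
      next
        case False
        then have "\<bar>u\<bar> powr \<rho> \<le> \<bar>u\<bar> powr real r" using \<rho> by (intro powr_mono) auto
        also have "\<dots> = \<bar>u\<bar> ^ r" using False by (intro powr_realpow) auto
        finally show ?thesis by simp
      qed
      then have u: "\<bar>b * u\<bar> powr \<rho> \<le> b powr \<rho> * (1 + \<bar>u\<bar> ^ r)"
        using b by (simp add: abs_mult powr_mult)
      have "\<bar>R u\<bar> \<le> (C * \<bar>b * u\<bar> powr \<rho>) * \<bar>K u\<bar>"
        unfolding R_def abs_mult P_def by (intro mult_right_mono) (use C(2)[of "b * u"] in \<open>auto simp: abs_mult\<close>)
      also have "\<dots> \<le> (C * (b powr \<rho> * (1 + \<bar>u\<bar> ^ r))) * \<bar>K u\<bar>"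
        using u C(1) by (intro mult_right_mono mult_left_mono) auto
      finally show "\<bar>R u\<bar> \<le> (C * b powr \<rho>) * (\<bar>K u\<bar> + \<bar>\<bar>u\<bar> ^ r * K u\<bar>)"
        by (simp add: abs_mult power_abs algebra_simps)
    qed (use intR in auto)
    also have "\<dots> = C * S * b powr \<rho>" by (simp add: S_def)
    finally show ?thesis .
  qed
  then show ?thesis using C(1) S unfolding \<rho>_def by (intro exI[of _ "C * S"]) auto
qed

section \<open>Covariances of bounded variables under mixing\<close>

text \<open>U is the average over x \<in> [0, 1] of the indicators of its superlevel sets, and averaging preserves
the bound \<beta>. The average is discretised to N levels at the cost of an error w / N.\<close>
lemma (in prob_space) expectation_bound_of_superlevels:
  fixes W U :: "'a \<Rightarrow> real"
  assumes [measurable]: "random_variable borel W" "random_variable borel U"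
    and W: "\<And>\<omega>. \<bar>W \<omega>\<bar> \<le> w"
    and U: "\<And>\<omega>. 0 \<le> U \<omega> \<and> U \<omega> \<le> 1"
    and level: "\<And>x. \<bar>expectation (\<lambda>\<omega>. W \<omega> * indicator {\<omega> \<in> space M. x \<le> U \<omega>} \<omega>)\<bar> \<le> \<beta>"
  shows "\<bar>expectation (\<lambda>\<omega>. W \<omega> * U \<omega>)\<bar> \<le> \<beta>"
proof -
  have *: "\<bar>expectation (\<lambda>\<omega>. W \<omega> * U \<omega>)\<bar> \<le> \<beta> + w / real (Suc n)" for n
  proof -
    define N where "N = Suc n"
    define S where "S i = {\<omega> \<in> space M. real i / real N \<le> U \<omega>}" for i
    \<comment> \<open>V is U rounded down to a multiple of 1 / N: the number of i \<in> {1..N} with i / N \<le> U is the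
      floor of N * U.\<close>
    define V where "V \<omega> = (\<Sum>i = 1..N. indicator (S i) \<omega>) / real N" for \<omega>
    have [measurable]: "S i \<in> sets M" for i unfolding S_def by measurable
    have V_meas [measurable]: "V \<in> borel_measurable M" unfolding V_def by measurable
    have N: "0 < N" by (simp add: N_def)
    have V: "\<bar>U \<omega> - V \<omega>\<bar> \<le> 1 / real N" if "\<omega> \<in> space M" for \<omega>
    proof -
      have NU: "real N * U \<omega> \<ge> 0" "real N * U \<omega> \<le> real N" using U[of \<omega>] N
        by (auto intro: mult_left_le)
      have "(\<Sum>i = 1..N. indicator (S i) \<omega> :: real) = real (card {i \<in> {1..N}. real i \<le> real N * U \<omega>})"
        using that N by (simp add: S_def indicator_def sum.If_cases field_simps Int_def)
      also have "{i \<in> {1..N}. real i \<le> real N * U \<omega>} = {1..nat \<lfloor>real N * U \<omega>\<rfloor>}"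
        using NU by (auto simp: le_nat_iff le_floor_iff nat_le_iff)
      also have "real (card \<dots>) = of_int \<lfloor>real N * U \<omega>\<rfloor>" using NU by simp
      finally have "V \<omega> = of_int \<lfloor>real N * U \<omega>\<rfloor> / real N" by (simp add: V_def)
      then have "U \<omega> - V \<omega> = (real N * U \<omega> - of_int \<lfloor>real N * U \<omega>\<rfloor>) / real N"
        using N by (simp add: field_simps)
      moreover have "0 \<le> real N * U \<omega> - of_int \<lfloor>real N * U \<omega>\<rfloor>"
        "real N * U \<omega> - of_int \<lfloor>real N * U \<omega>\<rfloor> \<le> 1" by linarith+
      ultimately show ?thesis using N by (simp add: divide_right_mono)
    qed
    have intW: "integrable M (\<lambda>\<omega>. W \<omega> * indicator (S i) \<omega>)" for i
      by (rule integrable_const_bound[where B = w]) (use W in \<open>auto simp: indicator_def intro: order_trans[OF abs_ge_zero]\<close>)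
    have "w \<ge> 0" using W[of undefined] by linarith
    have intWU: "integrable M (\<lambda>\<omega>. W \<omega> * U \<omega>)"
      by (rule integrable_const_bound[where B = "w * 1"])
        (use W U in \<open>auto simp: abs_mult simp del: mult_1_right intro!: AE_I2 mult_mono\<close>, use \<open>w \<ge> 0\<close> in auto)
    have WV: "(\<lambda>\<omega>. W \<omega> * V \<omega>) = (\<lambda>\<omega>. (\<Sum>i = 1..N. W \<omega> * indicator (S i) \<omega>) / real N)"
      by (simp add: V_def sum_distrib_left)
    have intWV: "integrable M (\<lambda>\<omega>. W \<omega> * V \<omega>)"
      unfolding WV by (rule integrable_divide, rule Bochner_Integration.integrable_sum, rule intW)
    have "\<bar>expectation (\<lambda>\<omega>. W \<omega> * V \<omega>)\<bar> = \<bar>\<Sum>i = 1..N. expectation (\<lambda>\<omega>. W \<omega> * indicator (S i) \<omega>)\<bar> / real N"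
      unfolding WV integral_divide_zero
      by (subst Bochner_Integration.integral_sum[OF intW]) (simp add: abs_divide)
    also have "\<dots> \<le> (\<Sum>i = 1..N. \<beta>) / real N"
      by (intro divide_right_mono order_trans[OF sum_abs] sum_mono) (auto simp: S_def level)
    also have "\<dots> = \<beta>" using N by simp
    finally have 1: "\<bar>expectation (\<lambda>\<omega>. W \<omega> * V \<omega>)\<bar> \<le> \<beta>" .
    have "\<bar>expectation (\<lambda>\<omega>. W \<omega> * U \<omega>) - expectation (\<lambda>\<omega>. W \<omega> * V \<omega>)\<bar>
        = \<bar>expectation (\<lambda>\<omega>. W \<omega> * (U \<omega> - V \<omega>))\<bar>"
      using intWU intWV by (simp add: right_diff_distrib)
    also have "\<dots> \<le> expectation (\<lambda>\<omega>. \<bar>W \<omega> * (U \<omega> - V \<omega>)\<bar>)" by (rule integral_abs_bound)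
    also have "\<dots> \<le> expectation (\<lambda>\<omega>. w * (1 / real N))"
    proof (rule integral_mono)
      show "integrable M (\<lambda>\<omega>. \<bar>W \<omega> * (U \<omega> - V \<omega>)\<bar>)"
        using intWU intWV by (simp add: right_diff_distrib)
      show "\<bar>W \<omega> * (U \<omega> - V \<omega>)\<bar> \<le> w * (1 / real N)" if "\<omega> \<in> space M" for \<omega>
        unfolding abs_mult using W V[OF that] \<open>w \<ge> 0\<close> by (intro mult_mono) auto
    qed simp
    finally show ?thesis using 1 by (simp add: N_def prob_space)
  qed
  have "(\<lambda>n. \<beta> + w / real (Suc n)) \<longlonglongrightarrow> \<beta> + 0"
    by (intro tendsto_intros LIMSEQ_Suc[OF lim_const_over_n])
  from LIMSEQ_le_const[OF this] * show ?thesis by auto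
qed

lemma (in prob_space) centered_expectation_bound_of_superlevels:
  fixes W X :: "'a \<Rightarrow> real"
  assumes [measurable]: "random_variable borel W" "random_variable borel X"
    and W: "\<And>\<omega>. \<bar>W \<omega>\<bar> \<le> w" "expectation W = 0"
    and X: "\<And>\<omega>. \<bar>X \<omega>\<bar> \<le> c" and c: "0 < c"
    and level: "\<And>x. \<bar>expectation (\<lambda>\<omega>. W \<omega> * indicator {\<omega> \<in> space M. x \<le> X \<omega>} \<omega>)\<bar> \<le> \<beta>"
  shows "\<bar>expectation (\<lambda>\<omega>. W \<omega> * X \<omega>)\<bar> \<le> 2 * c * \<beta>"
proof -
  \<comment> \<open>The affine map onto [0, 1] keeps the family of superlevel sets, and its additive constant drops
    out because W is centered; only the factor 2 * c remains.\<close>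
  define U where "U \<omega> = (X \<omega> + c) / (2 * c)" for \<omega>
  have [measurable]: "random_variable borel U" unfolding U_def by measurable
  have le: "x \<le> U \<omega> \<longleftrightarrow> 2 * c * x - c \<le> X \<omega>" for x \<omega>
    using c by (simp add: U_def field_simps)
  have "\<bar>expectation (\<lambda>\<omega>. W \<omega> * U \<omega>)\<bar> \<le> \<beta>"
  proof (rule expectation_bound_of_superlevels[OF _ _ W(1)])
    show "0 \<le> U \<omega> \<and> U \<omega> \<le> 1" for \<omega> using X[of \<omega>] c by (auto simp: U_def field_simps abs_le_iff)
  qed (auto simp: le level)
  moreover have "expectation (\<lambda>\<omega>. W \<omega> * X \<omega>) = 2 * c * expectation (\<lambda>\<omega>. W \<omega> * U \<omega>)"
  proof -
    have [simp]: "integrable M W" by (rule integrable_const_bound[where B = w]) (use W in auto)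
    have [simp]: "integrable M (\<lambda>\<omega>. W \<omega> * X \<omega>)"
      by (rule integrable_const_bound[where B = "w * c"])
        (use W X c in \<open>auto simp: abs_mult intro!: AE_I2 mult_mono intro: order_trans[OF abs_ge_zero]\<close>)
    have "(\<lambda>\<omega>. W \<omega> * U \<omega>) = (\<lambda>\<omega>. (W \<omega> * X \<omega> + c * W \<omega>) / (2 * c))"
      using c by (auto simp: U_def field_simps)
    then show ?thesis using c W(2) by simp
  qed
  ultimately show ?thesis using c by (simp add: abs_mult)
qed

text \<open>The classical covariance inequality for strongly mixing variables. Only superlevel sets enter, since
a bounded variable is an average of their indicators.\<close>
lemma (in prob_space) covariance_bound_of_superlevels:
  fixes X Y :: "'a \<Rightarrow> real"
  assumes [measurable]: "random_variable borel X" "random_variable borel Y"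
    and X: "\<And>\<omega>. \<bar>X \<omega>\<bar> \<le> c" and Y: "\<And>\<omega>. \<bar>Y \<omega>\<bar> \<le> c" and c: "0 < c"
    and mix: "\<And>x y. \<bar>prob ({\<omega> \<in> space M. x \<le> X \<omega>} \<inter> {\<omega> \<in> space M. y \<le> Y \<omega>})
        - prob {\<omega> \<in> space M. x \<le> X \<omega>} * prob {\<omega> \<in> space M. y \<le> Y \<omega>}\<bar> \<le> \<alpha>"
  shows "\<bar>expectation (\<lambda>\<omega>. X \<omega> * Y \<omega>) - expectation X * expectation Y\<bar> \<le> 4 * c\<^sup>2 * \<alpha>"
proof -
  have [simp]: "integrable M X" "integrable M Y" "integrable M (\<lambda>\<omega>. X \<omega> * Y \<omega>)"
    by (rule integrable_const_bound[where B = c], use X in auto,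
        rule integrable_const_bound[where B = c], use Y in auto,
        rule integrable_const_bound[where B = "c * c"])
      (use X Y c in \<open>auto simp: abs_mult intro!: AE_I2 mult_mono\<close>)
  define W where "W \<omega> = Y \<omega> - expectation Y" for \<omega>
  have [measurable]: "random_variable borel W" unfolding W_def by measurable
  have EY: "\<bar>expectation Y\<bar> \<le> c"
    using order_trans[OF integral_abs_bound[of M Y] integral_mono[of M "\<lambda>\<omega>. \<bar>Y \<omega>\<bar>" "\<lambda>_. c"]] Y
    by (simp add: prob_space)
  \<comment> \<open>The rounding argument is applied twice: first X is replaced by the indicator of one of its
    superlevel sets A, then the centering is moved from Y to that indicator and Y is replaced too.\<close>
  have "\<bar>expectation (\<lambda>\<omega>. W \<omega> * X \<omega>)\<bar> \<le> 2 * c * (2 * c * \<alpha>)"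
  proof (rule centered_expectation_bound_of_superlevels[OF _ _ _ _ X c])
    show "\<bar>W \<omega>\<bar> \<le> c + c" for \<omega> using Y[of \<omega>] EY unfolding W_def by linarith
    have "expectation W = expectation Y - expectation (\<lambda>_. expectation Y)"
      unfolding W_def by (rule Bochner_Integration.integral_diff) auto
    then show "expectation W = 0" by (simp add: prob_space)
    fix x
    define A where "A = {\<omega> \<in> space M. x \<le> X \<omega>}"
    have [measurable]: "A \<in> sets M" unfolding A_def by measurable
    define V where "V \<omega> = indicator A \<omega> - prob A" for \<omega>
    have [measurable]: "random_variable borel V" unfolding V_def by measurable
    have "\<bar>expectation (\<lambda>\<omega>. V \<omega> * Y \<omega>)\<bar> \<le> 2 * c * \<alpha>"
    proof (rule centered_expectation_bound_of_superlevels[OF _ _ _ _ Y c])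
      show "\<bar>V \<omega>\<bar> \<le> 1" for \<omega>
        using prob_le_1[of A] measure_nonneg[of M A] unfolding V_def
        by (auto simp: indicator_def abs_le_iff intro: order_trans[of _ 0] order_trans[of _ 1])
      have "expectation V = expectation (indicator A) - expectation (\<lambda>_. prob A)"
        unfolding V_def by (rule Bochner_Integration.integral_diff) (auto simp: emeasure_eq_measure)
      then show "expectation V = 0" by (simp add: prob_space)
      fix y
      define B where "B = {\<omega> \<in> space M. y \<le> Y \<omega>}"
      have [measurable]: "B \<in> sets M" unfolding B_def by measurable
      have "(\<lambda>\<omega>. V \<omega> * indicator B \<omega>) = (\<lambda>\<omega>. indicator (A \<inter> B) \<omega> - prob A * indicator B \<omega>)"
        by (auto simp: V_def indicator_def)
      then have "expectation (\<lambda>\<omega>. V \<omega> * indicator B \<omega>) = prob (A \<inter> B) - prob A * prob B"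
        by (simp add: emeasure_eq_measure)
      then show "\<bar>expectation (\<lambda>\<omega>. V \<omega> * indicator {\<omega> \<in> space M. y \<le> Y \<omega>} \<omega>)\<bar> \<le> \<alpha>"
        using mix[of x y] by (simp add: A_def B_def)
    qed auto
    moreover have "expectation (\<lambda>\<omega>. W \<omega> * indicator A \<omega>) = expectation (\<lambda>\<omega>. V \<omega> * Y \<omega>)"
    proof -
      have "integrable M (\<lambda>\<omega>. Y \<omega> * indicator A \<omega>)"
        by (rule integrable_real_mult_indicator) auto
      moreover have "(\<lambda>\<omega>. W \<omega> * indicator A \<omega>) = (\<lambda>\<omega>. Y \<omega> * indicator A \<omega> - expectation Y * indicator A \<omega>)"
        "(\<lambda>\<omega>. V \<omega> * Y \<omega>) = (\<lambda>\<omega>. Y \<omega> * indicator A \<omega> - prob A * Y \<omega>)"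
        by (auto simp: W_def V_def algebra_simps)
      ultimately show ?thesis by (simp add: emeasure_eq_measure)
    qed
    ultimately show "\<bar>expectation (\<lambda>\<omega>. W \<omega> * indicator {\<omega> \<in> space M. x \<le> X \<omega>} \<omega>)\<bar> \<le> 2 * c * \<alpha>"
      by (simp add: A_def)
  qed auto
  moreover have "expectation (\<lambda>\<omega>. W \<omega> * X \<omega>) = expectation (\<lambda>\<omega>. X \<omega> * Y \<omega>) - expectation X * expectation Y"
  proof -
    have "(\<lambda>\<omega>. W \<omega> * X \<omega>) = (\<lambda>\<omega>. X \<omega> * Y \<omega> - expectation Y * X \<omega>)"
      by (auto simp: W_def algebra_simps)
    then show ?thesis by simp
  qed
  ultimately show ?thesis by (simp add: power2_eq_square)
qed

text \<open>The windows are of size O(1 / b), so the covariance inequality costs a factor b powr (- 2). For v > 0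
this bound decays with the lag, but it is poor in b.\<close>
lemma (in prob_space) window_covariance_mixing_bound:
  fixes Z :: "int \<Rightarrow> 'a \<Rightarrow> real"
  assumes [measurable]: "\<And>t. random_variable borel (Z t)" and mix: "two_mixing M Z v"
    and K [measurable]: "K \<in> borel_measurable borel" and KB: "\<And>u. \<bar>K u\<bar> \<le> B"
  shows "\<exists>A\<ge>0. \<forall>b>0. \<forall>t \<tau>. t \<noteq> \<tau> \<longrightarrow>
    \<bar>expectation (\<lambda>\<omega>. scaled_kernel K b (Z t \<omega> - z) * scaled_kernel K b (Z \<tau> \<omega> - z))
      - expectation (\<lambda>\<omega>. scaled_kernel K b (Z t \<omega> - z)) * expectation (\<lambda>\<omega>. scaled_kernel K b (Z \<tau> \<omega> - z))\<bar>
    \<le> A * (b powr (- 2) * real_of_int \<bar>t - \<tau>\<bar> powr (- v))"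
proof -
  obtain C where C: "\<And>t \<tau> A B. t \<noteq> \<tau> \<Longrightarrow> A \<in> sigma_of M (Z t) \<Longrightarrow> B \<in> sigma_of M (Z \<tau>) \<Longrightarrow>
      \<bar>measure M (A \<inter> B) - measure M A * measure M B\<bar> \<le> C * real_of_int \<bar>t - \<tau>\<bar> powr (- v)"
    using mix unfolding two_mixing_def by metis
  \<comment> \<open>The bound on the windows has to be positive to rescale them to [0, 1].\<close>
  define B' where "B' = max 1 B"
  have B': "0 < B'" "\<And>u. \<bar>K u\<bar> \<le> B'" using order_trans[OF KB max.cobounded2] by (auto simp: B'_def)
  show ?thesis
  proof (intro exI[of _ "4 * B'\<^sup>2 * \<bar>C\<bar>"] conjI allI impI)
    fix b :: real and t \<tau> :: int assume b: "0 < b" and "t \<noteq> \<tau>"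
    define X where "X t \<omega> = scaled_kernel K b (Z t \<omega> - z)" for t \<omega>
    have X [measurable]: "random_variable borel (X t)" for t unfolding X_def scaled_kernel_def by measurable
    have level: "{\<omega> \<in> space M. x \<le> X t \<omega>} \<in> sigma_of M (Z t)" for x t
    proof -
      have "{y. x \<le> scaled_kernel K b (y - z)} \<in> sets borel" unfolding scaled_kernel_def by measurable
      then have "Z t -` {y. x \<le> scaled_kernel K b (y - z)} \<inter> space M \<in> sigma_of M (Z t)"
        unfolding sigma_of_def by (rule in_vimage_algebra)
      moreover have "Z t -` {y. x \<le> scaled_kernel K b (y - z)} \<inter> space M = {\<omega> \<in> space M. x \<le> X t \<omega>}"
        by (auto simp: X_def)
      ultimately show ?thesis by simp
    qed
    have "\<bar>X t \<omega>\<bar> \<le> B' / b" for t \<omega>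
      using B' b by (simp add: X_def scaled_kernel_def divide_right_mono)
    then have "\<bar>expectation (\<lambda>\<omega>. X t \<omega> * X \<tau> \<omega>) - expectation (X t) * expectation (X \<tau>)\<bar>
        \<le> 4 * (B' / b)\<^sup>2 * (\<bar>C\<bar> * real_of_int \<bar>t - \<tau>\<bar> powr (- v))"
    proof (intro covariance_bound_of_superlevels)
      fix x y
      have "\<bar>prob ({\<omega> \<in> space M. x \<le> X t \<omega>} \<inter> {\<omega> \<in> space M. y \<le> X \<tau> \<omega>})
          - prob {\<omega> \<in> space M. x \<le> X t \<omega>} * prob {\<omega> \<in> space M. y \<le> X \<tau> \<omega>}\<bar> \<le> C * real_of_int \<bar>t - \<tau>\<bar> powr (- v)"
        by (rule C[OF \<open>t \<noteq> \<tau>\<close> level level])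
      also have "\<dots> \<le> \<bar>C\<bar> * real_of_int \<bar>t - \<tau>\<bar> powr (- v)" by (intro mult_right_mono) auto
      finally show "\<bar>prob ({\<omega> \<in> space M. x \<le> X t \<omega>} \<inter> {\<omega> \<in> space M. y \<le> X \<tau> \<omega>})
          - prob {\<omega> \<in> space M. x \<le> X t \<omega>} * prob {\<omega> \<in> space M. y \<le> X \<tau> \<omega>}\<bar>
          \<le> \<bar>C\<bar> * real_of_int \<bar>t - \<tau>\<bar> powr (- v)" .
    qed (use B' b in auto)
    also have "\<dots> = 4 * B'\<^sup>2 * \<bar>C\<bar> * (b powr (- 2) * real_of_int \<bar>t - \<tau>\<bar> powr (- v))"
    proof -
      have "b powr (- 2) = 1 / b\<^sup>2" using b by (simp add: powr_minus_divide)
      then show ?thesis by (simp add: power_divide)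
    qed
    finally show "\<bar>expectation (\<lambda>\<omega>. scaled_kernel K b (Z t \<omega> - z) * scaled_kernel K b (Z \<tau> \<omega> - z))
      - expectation (\<lambda>\<omega>. scaled_kernel K b (Z t \<omega> - z)) * expectation (\<lambda>\<omega>. scaled_kernel K b (Z \<tau> \<omega> - z))\<bar>
      \<le> 4 * B'\<^sup>2 * \<bar>C\<bar> * (b powr (- 2) * real_of_int \<bar>t - \<tau>\<bar> powr (- v))"
      unfolding X_def .
  qed auto
qed

section \<open>Moments and covariances of windows from densities\<close>

text \<open>Squaring the window yields b powr (- 2), and the substitution u = (x - z) / b gives back one factor b.\<close>
lemma (in prob_space) second_moment_bound:
  assumes X: "has_density M X f" and f: "\<And>x. \<bar>f x\<bar> \<le> B" and K: "K \<in> borel_measurable borel"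
    "integrable lborel (\<lambda>u. (K u)\<^sup>2)" and b: "0 < b"
  shows "expectation (\<lambda>\<omega>. (scaled_kernel K b (X \<omega> - z))\<^sup>2) \<le> B * (\<integral>u. (K u)\<^sup>2 \<partial>lborel) * b powr (- 1)"
proof -
  note distr = X[unfolded has_density_def, THEN conjunct2]
  have f0: "\<And>x. 0 \<le> f x" using X by (auto simp: has_density_def)
  have [measurable]: "K \<in> borel_measurable borel" by fact
  have B: "0 \<le> B" using f[of 0] by linarith
  have "expectation (\<lambda>\<omega>. (scaled_kernel K b (X \<omega> - z))\<^sup>2) = (\<integral>x. f x * (K ((x - z) / b) / b)\<^sup>2 \<partial>lborel)"
    unfolding scaled_kernel_def
    by (rule distributed_integral[OF distr, symmetric]) (use f0 in auto)
  also have "\<dots> \<le> (\<integral>x. B * (K ((x - z) / b) / b)\<^sup>2 \<partial>lborel)"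
  proof (rule integral_mono')
    have "integrable lborel (\<lambda>x. (K (- z / b + 1 / b * x))\<^sup>2)"
      using lborel_integrable_real_affine[OF K(2), of "1 / b" "- z / b"] b by simp
    moreover have "- z / b + 1 / b * x = (x - z) / b" for x by (simp add: diff_divide_distrib)
    ultimately show "integrable lborel (\<lambda>x. B * (K ((x - z) / b) / b)\<^sup>2)"
      by (simp add: power_divide)
    show "f x * (K ((x - z) / b) / b)\<^sup>2 \<le> B * (K ((x - z) / b) / b)\<^sup>2" for x
      using f[of x] by (intro mult_right_mono) auto
  qed (use B in auto)
  also have "\<dots> = b * (\<integral>u. B * (K u / b)\<^sup>2 \<partial>lborel)"
    using integral_rescaled_window[OF b, of "\<lambda>x u. B * (K u / b)\<^sup>2" z] .
  also have "\<dots> = B * (\<integral>u. (K u)\<^sup>2 \<partial>lborel) * b powr (- 1)"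
    using b by (simp add: power_divide power2_eq_square powr_minus_divide)
  finally show ?thesis .
qed

text \<open>This splitting at a threshold \<mu> takes the place of Hoelder's inequality; a suitable \<mu> recovers
the same power of b.\<close>
lemma le_threshold_plus_powr:
  fixes a \<mu> p :: real
  assumes "0 \<le> a" "0 < \<mu>" "1 \<le> p"
  shows "a \<le> \<mu> + \<mu> powr (1 - p) * a powr p"
proof (cases "a \<le> \<mu>")
  case False
  then have "a powr (1 - p) \<le> \<mu> powr (1 - p)" using assms by (intro powr_mono2') auto
  then have "a powr (1 - p) * a powr p \<le> \<mu> powr (1 - p) * a powr p" by (intro mult_right_mono) auto
  then show ?thesis using assms False by (simp add: powr_add[symmetric])
qed (simp add: add_increasing2)

lemma has_bochner_integral_tensor:
  fixes g h :: "real \<Rightarrow> real"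
  assumes g: "integrable lborel g" and h: "integrable lborel h"
  shows "has_bochner_integral lborel (\<lambda>p. g (fst p) * h (snd p)) ((\<integral>x. g x \<partial>lborel) * (\<integral>y. h y \<partial>lborel))"
proof -
  have [measurable]: "g \<in> borel_measurable borel" "h \<in> borel_measurable borel"
    using g h borel_measurable_integrable by fastforce+
  have int: "integrable (lborel \<Otimes>\<^sub>M lborel) (\<lambda>p. g (fst p) * h (snd p))"
  proof (rule lborel_pair.Fubini_integrable)
    show "integrable lborel (\<lambda>x. \<integral>y. norm (g (fst (x, y)) * h (snd (x, y))) \<partial>lborel)"
      using g by (simp add: abs_mult)
  qed (use h in auto)
  have "integral\<^sup>L (lborel \<Otimes>\<^sub>M lborel) (\<lambda>p. g (fst p) * h (snd p)) = (\<integral>x. g x \<partial>lborel) * (\<integral>y. h y \<partial>lborel)"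
    using lborel_pair.integral_fst'[OF int] by simp
  then show ?thesis using int by (simp add: has_bochner_integral_iff lborel_prod)
qed

text \<open>The covariance is the integral of k \<otimes> k against G, the joint density minus the product of the
marginals. Where |G| \<le> \<mu> the integral of |k \<otimes> k| is used, and elsewhere the supremum of |k \<otimes> k| and
the p-th moment of G.\<close>
lemma (in prob_space) covariance_density_bound:
  fixes X Y :: "'a \<Rightarrow> real" and k :: "real \<Rightarrow> real" and G :: "real \<times> real \<Rightarrow> real"
  assumes X: "has_density M X f" and Y: "has_density M Y f"
    and XY: "has_density M (\<lambda>\<omega>. (X \<omega>, Y \<omega>)) f2"
    and G: "\<And>x y. G (x, y) = f2 (x, y) - f x * f y" "finite_Lp p G" and p: "1 \<le> p"
    and k: "integrable lborel k" "\<And>x. \<bar>k x\<bar> \<le> B" and \<mu>: "0 < \<mu>"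
  shows "\<bar>expectation (\<lambda>\<omega>. k (X \<omega>) * k (Y \<omega>)) - expectation (\<lambda>\<omega>. k (X \<omega>)) * expectation (\<lambda>\<omega>. k (Y \<omega>))\<bar>
    \<le> \<mu> * (\<integral>x. \<bar>k x\<bar> \<partial>lborel)\<^sup>2 + \<mu> powr (1 - p) * B\<^sup>2 * (\<integral>x. \<bar>G x\<bar> powr p \<partial>lborel)"
proof -
  note distr = X[unfolded has_density_def, THEN conjunct2] Y[unfolded has_density_def, THEN conjunct2]
    XY[unfolded has_density_def, THEN conjunct2]
  have nonneg: "\<And>x. 0 \<le> f x" "\<And>x. 0 \<le> f2 x" using X XY by (auto simp: has_density_def)
  have k_meas [measurable]: "k \<in> borel_measurable borel"
    using borel_measurable_integrable[OF k(1)] by simp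
  have [measurable]: "random_variable borel X" "random_variable borel Y"
    using distr(1,2) by (auto dest: distributed_measurable)
  have [measurable]: "G \<in> borel_measurable borel" using G(2) by (simp add: finite_Lp_def)
  define kk where "kk p = k (fst p) * k (snd p)" for p :: "real \<times> real"
  have kk_meas [measurable]: "kk \<in> borel_measurable borel"
    unfolding kk_def borel_prod[symmetric] by measurable
  have B: "0 \<le> B" using k(2)[of 0] by linarith
  have kk_le: "\<bar>kk x\<bar> \<le> B\<^sup>2" for x
    using k(2) B by (auto simp: kk_def abs_mult power2_eq_square intro!: mult_mono)
  have fk: "integrable lborel (\<lambda>x. f x * k x)"
    by (subst distributed_integrable[OF distr(1)])
      (use k nonneg in \<open>auto intro!: integrable_const_bound[where B = B]\<close>)
  have f2k: "integrable lborel (\<lambda>x. f2 x * kk x)"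
    by (subst distributed_integrable[OF distr(3)])
      (use kk_le nonneg in \<open>auto simp: kk_def intro!: integrable_const_bound[where B = "B\<^sup>2"]\<close>)
  have ffk: "has_bochner_integral lborel (\<lambda>x. (f (fst x) * k (fst x)) * (f (snd x) * k (snd x)))
      ((\<integral>x. f x * k x \<partial>lborel) * (\<integral>x. f x * k x \<partial>lborel))"
    by (rule has_bochner_integral_tensor[OF fk fk])
  have abskk: "has_bochner_integral lborel (\<lambda>x. \<bar>kk x\<bar>) ((\<integral>x. \<bar>k x\<bar> \<partial>lborel)\<^sup>2)"
    using has_bochner_integral_tensor[of "\<lambda>x. \<bar>k x\<bar>" "\<lambda>x. \<bar>k x\<bar>"] k(1)
    by (simp add: kk_def abs_mult power2_eq_square)
  have Gkk: "G x * kk x = f2 x * kk x - (f (fst x) * k (fst x)) * (f (snd x) * k (snd x))" for x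
    proof -
    have "G x = f2 x - f (fst x) * f (snd x)" using G(1)[of "fst x" "snd x"] by simp
    then show ?thesis by (simp only: kk_def) (simp only: algebra_simps)
  qed
  have intG: "integrable lborel (\<lambda>x. G x * kk x)"
    unfolding Gkk using f2k ffk by (auto simp: has_bochner_integral_iff)
  have intGp: "integrable lborel (\<lambda>x. \<bar>G x\<bar> powr p)" using G(2) by (simp add: finite_Lp_def)
  have E: "expectation (\<lambda>\<omega>. k (X \<omega>)) = (\<integral>x. f x * k x \<partial>lborel)"
    "expectation (\<lambda>\<omega>. k (Y \<omega>)) = (\<integral>x. f x * k x \<partial>lborel)"
    "expectation (\<lambda>\<omega>. k (X \<omega>) * k (Y \<omega>)) = (\<integral>x. f2 x * kk x \<partial>lborel)"
    using distributed_integral[OF distr(1), of k] distributed_integral[OF distr(2), of k]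
      distributed_integral[OF distr(3), of kk] nonneg by (auto simp: kk_def[symmetric]) (simp add: kk_def)
  have "expectation (\<lambda>\<omega>. k (X \<omega>) * k (Y \<omega>)) - expectation (\<lambda>\<omega>. k (X \<omega>)) * expectation (\<lambda>\<omega>. k (Y \<omega>))
      = (\<integral>x. G x * kk x \<partial>lborel)"
    unfolding E Gkk using f2k ffk by (simp add: has_bochner_integral_iff)
  also have "\<bar>\<dots>\<bar> \<le> (\<integral>x. \<bar>G x * kk x\<bar> \<partial>lborel)" by (rule integral_abs_bound)
  also have "\<dots> \<le> (\<integral>x. \<mu> * \<bar>kk x\<bar> + \<mu> powr (1 - p) * B\<^sup>2 * \<bar>G x\<bar> powr p \<partial>lborel)"
  proof (rule integral_mono)
    fix x
    have "\<bar>G x * kk x\<bar> \<le> (\<mu> + \<mu> powr (1 - p) * \<bar>G x\<bar> powr p) * \<bar>kk x\<bar>"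
      unfolding abs_mult using \<mu> p by (intro mult_right_mono le_threshold_plus_powr) auto
    also have "\<dots> = \<mu> * \<bar>kk x\<bar> + \<mu> powr (1 - p) * \<bar>kk x\<bar> * \<bar>G x\<bar> powr p" by (simp add: algebra_simps)
    also have "\<dots> \<le> \<mu> * \<bar>kk x\<bar> + \<mu> powr (1 - p) * B\<^sup>2 * \<bar>G x\<bar> powr p"
      using kk_le by (intro add_left_mono mult_right_mono mult_left_mono) auto
    finally show "\<bar>G x * kk x\<bar> \<le> \<mu> * \<bar>kk x\<bar> + \<mu> powr (1 - p) * B\<^sup>2 * \<bar>G x\<bar> powr p" .
  qed (use intG intGp abskk in \<open>auto simp: has_bochner_integral_iff\<close>)
  also have "\<dots> = \<mu> * (\<integral>x. \<bar>k x\<bar> \<partial>lborel)\<^sup>2 + \<mu> powr (1 - p) * B\<^sup>2 * (\<integral>x. \<bar>G x\<bar> powr p \<partial>lborel)"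
    using intGp abskk by (simp add: has_bochner_integral_iff)
  finally show ?thesis .
qed

text \<open>This bound says nothing about decay in the lag, but for p > 1 its order b powr (- 2 / p) is smaller
than the order b powr (- 2) of the mixing bound as b tends to 0.\<close>
lemma (in prob_space) window_covariance_density_bound:
  fixes X Y :: "'a \<Rightarrow> real"
  assumes X: "has_density M X f" and Y: "has_density M Y f"
    and XY: "has_density M (\<lambda>\<omega>. (X \<omega>, Y \<omega>)) f2"
    and G: "\<And>x y. G (x, y) = f2 (x, y) - f x * f y" "finite_Lp p G" "Lp_norm p G \<le> N"
    and p: "1 \<le> p" and K: "integrable lborel K" "\<And>u. \<bar>K u\<bar> \<le> B" and b: "0 < b"
  shows "\<bar>expectation (\<lambda>\<omega>. scaled_kernel K b (X \<omega> - z) * scaled_kernel K b (Y \<omega> - z))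
      - expectation (\<lambda>\<omega>. scaled_kernel K b (X \<omega> - z)) * expectation (\<lambda>\<omega>. scaled_kernel K b (Y \<omega> - z))\<bar>
    \<le> ((\<integral>u. \<bar>K u\<bar> \<partial>lborel)\<^sup>2 + B\<^sup>2 * N powr p) * b powr (- 2 / p)"
proof -
  define k where "k x = scaled_kernel K b (x - z)" for x
  \<comment> \<open>At this threshold both terms of the bound have the same order in b.\<close>
  define \<mu> where "\<mu> = b powr (- 2 / p)"
  have B: "\<bar>k x\<bar> \<le> B / b" for x
    using K(2) b by (simp add: k_def scaled_kernel_def divide_right_mono)
  have int_k: "integrable lborel k"
  proof -
    have "integrable lborel (\<lambda>x. K (- z / b + 1 / b * x))"
      using lborel_integrable_real_affine[OF K(1), of "1 / b" "- z / b"] b by simp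
    moreover have "- z / b + 1 / b * x = (x - z) / b" for x by (simp add: diff_divide_distrib)
    ultimately show ?thesis by (simp add: k_def[abs_def] scaled_kernel_def)
  qed
  have norm_k: "(\<integral>x. \<bar>k x\<bar> \<partial>lborel) = (\<integral>u. \<bar>K u\<bar> \<partial>lborel)"
    using integral_rescaled_window[OF b, of "\<lambda>x u. \<bar>K u / b\<bar>" z] b
    by (simp add: k_def scaled_kernel_def abs_divide)
  have Gp: "(\<integral>x. \<bar>G x\<bar> powr p \<partial>lborel) \<le> N powr p"
  proof -
    have "0 \<le> (\<integral>x. \<bar>G x\<bar> powr p \<partial>lborel)" by (intro integral_nonneg_AE) auto
    then have "(\<integral>x. \<bar>G x\<bar> powr p \<partial>lborel) = Lp_norm p G powr p"
      using p by (simp add: Lp_norm_def powr_powr)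
    also have "\<dots> \<le> N powr p" using G(3) p by (intro powr_mono2) (auto simp: Lp_norm_def)
    finally show ?thesis .
  qed
  have \<mu>p: "\<mu> powr (1 - p) * (B / b)\<^sup>2 = B\<^sup>2 * \<mu>"
  proof -
    have "- 2 / p * (1 - p) - 2 = - 2 / p" using p by (simp add: field_simps)
    then have "\<mu> powr (1 - p) * b powr (- 2) = \<mu>"
      unfolding \<mu>_def powr_powr powr_add[symmetric] by simp
    moreover have "b powr (- 2) = 1 / b\<^sup>2" using b by (simp add: powr_minus_divide)
    moreover have "\<mu> powr (1 - p) * (B / b)\<^sup>2 = B\<^sup>2 * (\<mu> powr (1 - p) * (1 / b\<^sup>2))"
      by (simp add: power_divide)
    ultimately show ?thesis by simp
  qed
  have "0 < \<mu>" using b by (simp add: \<mu>_def)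
  then have "\<bar>expectation (\<lambda>\<omega>. k (X \<omega>) * k (Y \<omega>)) - expectation (\<lambda>\<omega>. k (X \<omega>)) * expectation (\<lambda>\<omega>. k (Y \<omega>))\<bar>
    \<le> \<mu> * (\<integral>x. \<bar>k x\<bar> \<partial>lborel)\<^sup>2 + \<mu> powr (1 - p) * (B / b)\<^sup>2 * (\<integral>x. \<bar>G x\<bar> powr p \<partial>lborel)"
    by (intro covariance_density_bound[OF X Y XY G(1,2) p int_k B])
  also have "\<dots> = \<mu> * (\<integral>u. \<bar>K u\<bar> \<partial>lborel)\<^sup>2 + B\<^sup>2 * \<mu> * (\<integral>x. \<bar>G x\<bar> powr p \<partial>lborel)"
    unfolding \<mu>p norm_k ..
  also have "\<dots> \<le> \<mu> * (\<integral>u. \<bar>K u\<bar> \<partial>lborel)\<^sup>2 + B\<^sup>2 * \<mu> * N powr p"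
    using Gp \<open>0 < \<mu>\<close> by (intro add_left_mono mult_left_mono) auto
  finally show ?thesis by (simp add: k_def \<mu>_def algebra_simps)
qed

text \<open>The joint densities are controlled only for pairs whose first index is 0; this shift extends the
control to all pairs.\<close>
lemma stationary_pair_expectation:
  fixes Z :: "int \<Rightarrow> 'w \<Rightarrow> real" and g :: "real \<Rightarrow> real"
  assumes Z: "stationary M Z" and g [measurable]: "g \<in> borel_measurable borel"
  shows "(\<integral>\<omega>. g (Z t \<omega>) * g (Z \<tau> \<omega>) \<partial>M) = (\<integral>\<omega>. g (Z 0 \<omega>) * g (Z (\<tau> - t) \<omega>) \<partial>M)"
proof -
  define J where "J = {0, \<tau> - t}"
  define G where "G x = g (x 0) * g (x (\<tau> - t))" for x :: "int \<Rightarrow> real"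
  have [measurable]: "Z u \<in> borel_measurable M" for u using Z by (simp add: stationary_def)
  have G [measurable]: "G \<in> borel_measurable (PiM J (\<lambda>_. borel))"
    unfolding G_def J_def by measurable
  have "distr M (PiM J (\<lambda>_. borel)) (\<lambda>\<omega>. \<lambda>u\<in>J. Z (u + t) \<omega>) = distr M (PiM J (\<lambda>_. borel)) (\<lambda>\<omega>. \<lambda>u\<in>J. Z u \<omega>)"
    using Z[unfolded stationary_def, THEN conjunct2, rule_format, of J t] by (simp add: J_def)
  then have "integral\<^sup>L (distr M (PiM J (\<lambda>_. borel)) (\<lambda>\<omega>. \<lambda>u\<in>J. Z (u + t) \<omega>)) G
      = integral\<^sup>L (distr M (PiM J (\<lambda>_. borel)) (\<lambda>\<omega>. \<lambda>u\<in>J. Z u \<omega>)) G" by simp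
  then have "(\<integral>\<omega>. G (\<lambda>u\<in>J. Z (u + t) \<omega>) \<partial>M) = (\<integral>\<omega>. G (\<lambda>u\<in>J. Z u \<omega>) \<partial>M)"
    by (subst (asm) (1 2) integral_distr) simp_all
  then show ?thesis by (simp add: G_def J_def)
qed

section \<open>Sums of covariance bounds over lags\<close>

lemma powr_le_increment_below_one:
  fixes v :: real
  assumes v: "0 \<le> v" "v < 1" and n: "0 < n"
  shows "real n powr (- v) \<le> (real n powr (1 - v) - real (n - 1) powr (1 - v)) / (1 - v)"
proof (cases "n = 1")
  case True
  then show ?thesis using v by (simp add: field_simps)
next
  case False
  then have n1: "0 < real (n - 1)" "real (n - 1) < real n" "real n - real (n - 1) = 1" using n by auto
  have "\<exists>\<xi>. real (n - 1) < \<xi> \<and> \<xi> < real n \<and> real n powr (1 - v) - real (n - 1) powr (1 - v)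
      = (real n - real (n - 1)) * ((1 - v) * \<xi> powr (- v))"
    by (rule MVT2) (use n1 v in \<open>auto intro!: derivative_eq_intros simp: mult_ac\<close>)
  then obtain \<xi> where \<xi>: "real (n - 1) < \<xi>" "\<xi> < real n"
    "real n powr (1 - v) - real (n - 1) powr (1 - v) = (1 - v) * \<xi> powr (- v)"
    using n1 by auto
  have "real n powr (- v) \<le> \<xi> powr (- v)" using \<xi> v n1 by (intro powr_mono2') auto
  then show ?thesis using \<xi>(3) v by simp
qed

text \<open>For 0 \<le> v < 1 the sum telescopes against the antiderivative of x powr (- v). For v < 0 the
summands increase, and the last one bounds them all.\<close>
lemma sum_powr_below_one:
  fixes v :: real
  assumes v: "v < 1"
  shows "(\<Sum>h = 1..n. real h powr (- v)) \<le> max 1 (1 / (1 - v)) * real n powr (1 - v)"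
proof (cases "v \<ge> 0")
  case True
  have "(\<Sum>h = 1..n. real h powr (- v)) \<le> real n powr (1 - v) / (1 - v)"
  proof (induction n)
    case (Suc n)
    then show ?case using powr_le_increment_below_one[OF True v, of "Suc n"]
      by (simp add: diff_divide_distrib)
  qed simp
  also have "\<dots> \<le> max 1 (1 / (1 - v)) * real n powr (1 - v)"
    using mult_right_mono[of "1 / (1 - v)" "max 1 (1 / (1 - v))" "real n powr (1 - v)"] by simp
  finally show ?thesis .
next
  case False
  have "(\<Sum>h = 1..n. real h powr (- v)) \<le> (\<Sum>h = 1..n. real n powr (- v))"
    using False by (intro sum_mono powr_mono2) auto
  also have "\<dots> = real n powr (1 - v)"
    using powr_add[of "real n" 1 "- v"] by (cases "n = 0") auto
  also have "\<dots> \<le> max 1 (1 / (1 - v)) * real n powr (1 - v)"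
    using mult_right_mono[of 1 "max 1 (1 / (1 - v))" "real n powr (1 - v)"] by simp
  finally show ?thesis .
qed

lemma powr_le_decrement_above_one:
  fixes v :: real
  assumes v: "1 < v" and n: "0 < n"
  shows "real n powr (- v) \<le> 2 powr v / (v - 1) * (real n powr (1 - v) - real (Suc n) powr (1 - v))"
proof -
  have "\<exists>\<xi>. real n < \<xi> \<and> \<xi> < real (Suc n) \<and> real (Suc n) powr (1 - v) - real n powr (1 - v)
      = (real (Suc n) - real n) * ((1 - v) * \<xi> powr (- v))"
    by (rule MVT2) (use n v in \<open>auto intro!: derivative_eq_intros simp: mult_ac\<close>)
  then obtain \<xi> where \<xi>: "real n < \<xi>" "\<xi> < real (Suc n)"
    "real n powr (1 - v) - real (Suc n) powr (1 - v) = (v - 1) * \<xi> powr (- v)"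
    by (auto simp: algebra_simps)
  \<comment> \<open>The mean value sits in (n, n + 1), inside (n, 2 * n]; this is the origin of 2 powr v.\<close>
  have "(2 * real n) powr (- v) \<le> \<xi> powr (- v)" using \<xi> v n by (intro powr_mono2') auto
  then have "2 powr v * (2 powr (- v) * real n powr (- v)) \<le> 2 powr v * \<xi> powr (- v)"
    by (simp add: powr_mult)
  then have "real n powr (- v) \<le> 2 powr v * \<xi> powr (- v)"
    by (simp add: mult.assoc[symmetric] powr_add[symmetric])
  then show ?thesis using \<xi>(3) v by simp
qed

lemma sum_powr_tail_above_one:
  fixes v H :: real
  assumes v: "1 < v" and H: "1 \<le> H"
  shows "(\<Sum>h \<in> {h \<in> {1..n}. H < real h}. real h powr (- v)) \<le> 2 powr v / (v - 1) * H powr (1 - v)"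
proof -
  define C where "C = 2 powr v / (v - 1)"
  have C: "0 \<le> C" using v by (simp add: C_def)
  \<comment> \<open>The maximum keeps the telescoping bound valid while n has not yet reached H.\<close>
  have "(\<Sum>h \<in> {h \<in> {1..n}. H < real h}. real h powr (- v))
      \<le> C * (H powr (1 - v) - max H (real (Suc n)) powr (1 - v))"
  proof (induction n)
    case 0
    then show ?case using H by simp
  next
    case (Suc n)
    show ?case
    proof (cases "H < real (Suc n)")
      case True
      then have "{h \<in> {1..Suc n}. H < real h} = insert (Suc n) {h \<in> {1..n}. H < real h}"
        by (auto simp: le_Suc_eq)
      then have "(\<Sum>h \<in> {h \<in> {1..Suc n}. H < real h}. real h powr (- v)) =
          real (Suc n) powr (- v) + (\<Sum>h \<in> {h \<in> {1..n}. H < real h}. real h powr (- v))" by simp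
      also have "\<dots> \<le> C * (real (Suc n) powr (1 - v) - real (Suc (Suc n)) powr (1 - v))
          + C * (H powr (1 - v) - max H (real (Suc n)) powr (1 - v))"
        using Suc.IH powr_le_decrement_above_one[OF v, of "Suc n"] by (intro add_mono) (auto simp: C_def)
      finally show ?thesis using True by (simp add: algebra_simps max_def)
    next
      case False
      then have "{h \<in> {1..Suc n}. H < real h} = {}" by auto
      moreover have "max H (real (Suc (Suc n))) powr (1 - v) \<le> H powr (1 - v)"
        using H v by (intro powr_mono2') auto
      ultimately show ?thesis using C by (simp only: sum.empty) (intro mult_nonneg_nonneg, auto)
    qed
  qed
  also have "\<dots> \<le> C * H powr (1 - v)" using C by (intro mult_left_mono) auto
  finally show ?thesis by (simp add: C_def)
qed

text \<open>The bound without decay is used for lags up to b powr (- q) and the decaying one beyond. The two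
bounds need not cross there; this cutoff is the one at which the near lags cost b powr (- 1), the
order of the variance of a single window.\<close>
lemma sum_two_bounds_above_one:
  fixes v q b :: real
  assumes v: "1 < v" and q: "0 < q" and b: "0 < b"
    and \<phi>: "\<And>h. h \<in> {1..n} \<Longrightarrow> \<phi> h \<le> b powr (q - 1)"
      "\<And>h. h \<in> {1..n} \<Longrightarrow> \<phi> h \<le> b powr (- 2) * real h powr (- v)"
  shows "(\<Sum>h = 1..n. \<phi> h) \<le> (1 + 2 powr v / (v - 1)) * (b powr (- 1) + b powr (- 2 - q * (1 - v)))"
proof -
  define C where "C = 2 powr v / (v - 1)"
  have C: "0 \<le> C" using v by (simp add: C_def)
  have split: "(\<Sum>h = 1..n. \<phi> h) = (\<Sum>h \<in> {h \<in> {1..n}. \<not> H < real h}. \<phi> h) + (\<Sum>h \<in> {h \<in> {1..n}. H < real h}. \<phi> h)" for H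
    by (subst sum.union_disjoint[symmetric]) (auto intro!: sum.cong)
  have tail: "(\<Sum>h \<in> {h \<in> {1..n}. H < real h}. \<phi> h) \<le> b powr (- 2) * (C * H powr (1 - v))" if "1 \<le> H" for H
  proof -
    have "(\<Sum>h \<in> {h \<in> {1..n}. H < real h}. \<phi> h) \<le> (\<Sum>h \<in> {h \<in> {1..n}. H < real h}. b powr (- 2) * real h powr (- v))"
      using \<phi>(2) by (intro sum_mono) auto
    also have "\<dots> = b powr (- 2) * (\<Sum>h \<in> {h \<in> {1..n}. H < real h}. real h powr (- v))"
      by (simp add: sum_distrib_left)
    also have "\<dots> \<le> b powr (- 2) * (C * H powr (1 - v))"
      using sum_powr_tail_above_one[OF v that, of n] by (intro mult_left_mono) (auto simp: C_def)
    finally show ?thesis .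
  qed
  have "(\<Sum>h = 1..n. \<phi> h) \<le> b powr (- 1) + b powr (- 2 - q * (1 - v)) + C * b powr (- 2 - q * (1 - v))"
  proof (cases "b \<le> 1")
    case True
    \<comment> \<open>At this cutoff the near lags contribute at most b powr (- 1).\<close>
    define H where "H = b powr (- q)"
    have H: "1 \<le> H" using True b q powr_mono2'[of "-q" b 1] by (auto simp: H_def)
    have "{h \<in> {1..n}. \<not> H < real h} \<subseteq> {1..nat \<lfloor>H\<rfloor>}" by (auto simp: le_nat_iff le_floor_iff)
    then have "card {h \<in> {1..n}. \<not> H < real h} \<le> nat \<lfloor>H\<rfloor>" using card_mono[of "{1..nat \<lfloor>H\<rfloor>}"] by simp
    then have card: "real (card {h \<in> {1..n}. \<not> H < real h}) \<le> H" using H by linarith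
    have "(\<Sum>h \<in> {h \<in> {1..n}. \<not> H < real h}. \<phi> h) \<le> (\<Sum>h \<in> {h \<in> {1..n}. \<not> H < real h}. b powr (q - 1))"
      using \<phi>(1) by (intro sum_mono) auto
    also have "\<dots> = real (card {h \<in> {1..n}. \<not> H < real h}) * b powr (q - 1)" by simp
    also have "\<dots> \<le> H * b powr (q - 1)" using card by (intro mult_right_mono) auto
    also have "\<dots> = b powr (- 1)" unfolding H_def by (simp add: powr_add[symmetric])
    finally have 1: "(\<Sum>h \<in> {h \<in> {1..n}. \<not> H < real h}. \<phi> h) \<le> b powr (- 1)" .
    have "b powr (- 2) * (C * H powr (1 - v)) = C * b powr (- 2 - q * (1 - v))"
    proof -
      have "- 2 + - q * (1 - v) = - 2 - q * (1 - v)" by simp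
      then have "b powr (- 2) * H powr (1 - v) = b powr (- 2 - q * (1 - v))"
        unfolding H_def powr_powr powr_add[symmetric] by simp
      then show ?thesis by (simp add: mult.left_commute)
    qed
    then show ?thesis using 1 tail[OF H] split[of H] powr_ge_zero[of b "- 2 - q * (1 - v)"] by linarith
  next
    case False
    \<comment> \<open>For b > 1 the cutoff would lie below 1, so the decaying bound is used at every lag; the tail
      estimate covers all lags but the first.\<close>
    have "{h \<in> {1..n}. \<not> 1 < real h} \<subseteq> {1}" by auto
    then have "{h \<in> {1..n}. \<not> 1 < real h} = {} \<or> {h \<in> {1..n}. \<not> 1 < real h} = {1}" by blast
    then have 1: "(\<Sum>h \<in> {h \<in> {1..n}. \<not> 1 < real h}. \<phi> h) \<le> b powr (- 2)"
    proof
      assume "{h \<in> {1..n}. \<not> 1 < real h} = {1}"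
      moreover from this have "1 \<in> {1..n}" by blast
      ultimately show ?thesis using \<phi>(2)[of 1] by simp
    next
      assume "{h \<in> {1..n}. \<not> 1 < real h} = {}"
      then show ?thesis by (simp only: sum.empty) simp
    qed
    have 2: "b powr (- 2) \<le> b powr (- 2 - q * (1 - v))"
      using False q v by (intro powr_mono) (auto simp: mult_nonneg_nonpos)
    then have "C * b powr (- 2) \<le> C * b powr (- 2 - q * (1 - v))" using C by (rule mult_left_mono)
    moreover have "b powr (- 2) * (C * 1 powr (1 - v)) = C * b powr (- 2)" by simp
    ultimately show ?thesis using 1 2 tail[of 1] split[of 1] powr_ge_zero[of b "- 1"] by linarith
  qed
  also have "\<dots> \<le> (1 + C) * (b powr (- 1) + b powr (- 2 - q * (1 - v)))"
    using C by (simp add: algebra_simps divide_right_mono)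
  finally show ?thesis by (simp add: C_def)
qed

text \<open>For v < 1 the bound with h powr (- v) alone suffices. Both cases agree with the common formula because max v 1 and min v 1 select the exponents.\<close>
lemma sum_two_bounds:
  fixes v q :: real
  assumes "v \<noteq> 1" and q: "0 < q"
  shows "\<exists>C\<ge>0. \<forall>b>0. \<forall>n \<phi>. 0 < n \<longrightarrow>
    (\<forall>h \<in> {1..n}. \<phi> h \<le> b powr (q - 1) \<and> \<phi> h \<le> b powr (- 2) * real h powr (- v)) \<longrightarrow>
    (\<Sum>h = 1..n. \<phi> h) / real n \<le> C * (b powr (- 1) * real n powr (- 1)
          + b powr (- 2 - q * (1 - max v 1)) * real n powr (- min v 1))"
proof (cases "v < 1")
  case True
  define C where "C = max 1 (1 / (1 - v))"
  have C: "0 \<le> C" by (simp add: C_def)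
  show ?thesis
  proof (intro exI[of _ C] conjI allI impI)
    fix b :: real and n :: nat and \<phi> :: "nat \<Rightarrow> real"
    assume b: "0 < b" and n: "0 < n"
      and \<phi>: "\<forall>h \<in> {1..n}. \<phi> h \<le> b powr (q - 1) \<and> \<phi> h \<le> b powr (- 2) * real h powr (- v)"
    have "(\<Sum>h = 1..n. \<phi> h) \<le> (\<Sum>h = 1..n. b powr (- 2) * real h powr (- v))"
      using \<phi> by (intro sum_mono) auto
    also have "\<dots> = b powr (- 2) * (\<Sum>h = 1..n. real h powr (- v))" by (simp add: sum_distrib_left)
    also have "\<dots> \<le> b powr (- 2) * (C * real n powr (1 - v))"
      using sum_powr_below_one[OF True, of n] by (intro mult_left_mono) (auto simp: C_def)
    finally have "(\<Sum>h = 1..n. \<phi> h) / real n \<le> C * b powr (- 2) * (real n powr (1 - v) / real n)"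
      using n by (simp add: divide_right_mono mult_ac)
    also have "real n powr (1 - v) / real n = real n powr (- v)"
      using n by (simp add: powr_diff powr_minus_divide)
    also have "C * b powr (- 2) * real n powr (- v) \<le> C * (b powr (- 1) * real n powr (- 1)
          + b powr (- 2 - q * (1 - max v 1)) * real n powr (- min v 1))"
      using True C by (simp add: algebra_simps)
    finally show "(\<Sum>h = 1..n. \<phi> h) / real n \<le> C * (b powr (- 1) * real n powr (- 1)
          + b powr (- 2 - q * (1 - max v 1)) * real n powr (- min v 1))" .
  qed (rule C)
next
  case False
  then have v: "1 < v" using assms by simp
  define C where "C = 1 + 2 powr v / (v - 1)"
  have C: "0 \<le> C" using v by (simp add: C_def)
  show ?thesis
  proof (intro exI[of _ C] conjI allI impI)
    fix b :: real and n :: nat and \<phi> :: "nat \<Rightarrow> real"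
    assume b: "0 < b" and n: "0 < n"
      and \<phi>: "\<forall>h \<in> {1..n}. \<phi> h \<le> b powr (q - 1) \<and> \<phi> h \<le> b powr (- 2) * real h powr (- v)"
    have "(\<Sum>h = 1..n. \<phi> h) / real n \<le> C * (b powr (- 1) + b powr (- 2 - q * (1 - v))) / real n"
      using sum_two_bounds_above_one[OF v q b, of n \<phi>] \<phi> by (intro divide_right_mono) (auto simp: C_def)
    also have "\<dots> = C * (b powr (- 1) * real n powr (- 1)
          + b powr (- 2 - q * (1 - max v 1)) * real n powr (- min v 1))"
    proof -
      have "real n powr (- 1) = 1 / real n" using n by (simp add: powr_minus_divide)
      then show ?thesis using v by (simp add: algebra_simps add_divide_distrib)
    qed
    finally show "(\<Sum>h = 1..n. \<phi> h) / real n \<le> C * (b powr (- 1) * real n powr (- 1)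
          + b powr (- 2 - q * (1 - max v 1)) * real n powr (- min v 1))" .
  qed (rule C)
qed

section \<open>Mean squared error\<close>

lemma double_sum_le_lag_sum:
  fixes c :: "int \<Rightarrow> int \<Rightarrow> real" and \<phi> :: "nat \<Rightarrow> real"
  assumes c: "\<And>t \<tau>. c t \<tau> \<le> \<phi> (nat \<bar>t - \<tau>\<bar>)" and \<phi>: "\<And>h. 0 \<le> \<phi> h"
  shows "(\<Sum>t = 1..n. \<Sum>\<tau> = 1..n. c (int t) (int \<tau>)) \<le> real n * (\<phi> 0 + 2 * (\<Sum>h = 1..n. \<phi> h))"
proof -
  have row: "(\<Sum>\<tau> = 1..n. c (int t) (int \<tau>)) \<le> \<phi> 0 + 2 * (\<Sum>h = 1..n. \<phi> h)" if t: "t \<in> {1..n}" for t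
  proof -
    have "(\<Sum>\<tau> = 1..n. c (int t) (int \<tau>)) \<le> (\<Sum>\<tau> = 1..n. \<phi> (nat \<bar>int t - int \<tau>\<bar>))"
      by (intro sum_mono c)
    also have "(\<Sum>\<tau> = 1..n. \<phi> (nat \<bar>int t - int \<tau>\<bar>)) =
        (\<Sum>\<tau> \<in> {1..<t} \<union> {t} \<union> {t<..n}. \<phi> (nat \<bar>int t - int \<tau>\<bar>))"
      using t by (intro sum.cong) auto
    also have "(\<Sum>\<tau> \<in> {1..<t} \<union> {t} \<union> {t<..n}. \<phi> (nat \<bar>int t - int \<tau>\<bar>))
        = (\<Sum>\<tau> \<in> {1..<t}. \<phi> (nat \<bar>int t - int \<tau>\<bar>)) + \<phi> (nat \<bar>int t - int t\<bar>)
          + (\<Sum>\<tau> \<in> {t<..n}. \<phi> (nat \<bar>int t - int \<tau>\<bar>))"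
      by (subst sum.union_disjoint) auto
    also have "(\<Sum>\<tau> \<in> {1..<t}. \<phi> (nat \<bar>int t - int \<tau>\<bar>)) = (\<Sum>\<tau> \<in> {1..<t}. \<phi> (t - \<tau>))"
      by (intro sum.cong arg_cong[of _ _ \<phi>]) auto
    also have "(\<Sum>\<tau> \<in> {t<..n}. \<phi> (nat \<bar>int t - int \<tau>\<bar>)) = (\<Sum>\<tau> \<in> {t<..n}. \<phi> (\<tau> - t))"
      by (intro sum.cong arg_cong[of _ _ \<phi>]) auto
    also have "(\<Sum>\<tau> \<in> {1..<t}. \<phi> (t - \<tau>)) = (\<Sum>h \<in> (\<lambda>\<tau>. t - \<tau>) ` {1..<t}. \<phi> h)"
      by (subst sum.reindex) (auto simp: inj_on_def)
    also have "\<dots> \<le> (\<Sum>h = 1..n. \<phi> h)" using t \<phi> by (intro sum_mono2) auto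
    also have "(\<Sum>\<tau> \<in> {t<..n}. \<phi> (\<tau> - t)) = (\<Sum>h \<in> (\<lambda>\<tau>. \<tau> - t) ` {t<..n}. \<phi> h)"
      by (subst sum.reindex) (auto simp: inj_on_def)
    also have "\<dots> \<le> (\<Sum>h = 1..n. \<phi> h)" using t \<phi> by (intro sum_mono2) auto
    finally show ?thesis by simp
  qed
  have "(\<Sum>t = 1..n. \<Sum>\<tau> = 1..n. c (int t) (int \<tau>)) \<le> (\<Sum>t = 1..n. \<phi> 0 + 2 * (\<Sum>h = 1..n. \<phi> h))"
    by (intro sum_mono row) auto
  then show ?thesis by simp
qed

text \<open>Variance plus squared bias, with the double sum of covariances grouped by lag.\<close>
lemma (in prob_space) sample_mean_mse_bound:
  fixes X :: "int \<Rightarrow> 'a \<Rightarrow> real" and \<phi> :: "nat \<Rightarrow> real"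
  assumes X [measurable]: "\<And>t. random_variable borel (X t)" and bdd: "\<And>t \<omega>. \<bar>X t \<omega>\<bar> \<le> c"
    and mean: "\<And>t. expectation (X t) = m"
    and cov: "\<And>t \<tau>. expectation (\<lambda>\<omega>. X t \<omega> * X \<tau> \<omega>) - m\<^sup>2 \<le> \<phi> (nat \<bar>t - \<tau>\<bar>)"
    and \<phi>: "\<And>h. 0 \<le> \<phi> h" and n: "0 < n"
  shows "expectation (\<lambda>\<omega>. (1 / real n * (\<Sum>t = 1..n. X (int t) \<omega>) - a)\<^sup>2)
      \<le> (\<phi> 0 + 2 * (\<Sum>h = 1..n. \<phi> h)) / real n + (m - a)\<^sup>2"
proof -
  have [simp]: "integrable M (X t)" for t
    by (rule integrable_const_bound[where B = c]) (use bdd in auto)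
  have c: "0 \<le> c" using order_trans[OF abs_ge_zero bdd] .
  have XX [simp]: "integrable M (\<lambda>\<omega>. X t \<omega> * X \<tau> \<omega>)" for t \<tau>
    by (rule integrable_const_bound[where B = "c * c"]) (use bdd c in \<open>auto simp: abs_mult intro!: AE_I2 mult_mono\<close>)
  define W where "W t \<omega> = X t \<omega> - m" for t \<omega>
  have W [simp]: "integrable M (W t)" "expectation (W t) = 0" for t
    unfolding W_def by (simp_all add: mean prob_space)
  \<comment> \<open>Every term but X t * X \<tau> is a constant or a multiple of a centered variable.\<close>
  have WW: "W t \<omega> * W \<tau> \<omega> = X t \<omega> * X \<tau> \<omega> - m * W t \<omega> - m * W \<tau> \<omega> - m\<^sup>2" for t \<tau> \<omega>
    by (simp add: W_def algebra_simps power2_eq_square)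
  have intWW [simp]: "integrable M (\<lambda>\<omega>. W t \<omega> * W \<tau> \<omega>)" for t \<tau>
    unfolding WW by (intro Bochner_Integration.integrable_diff XX integrable_mult_right W) auto
  have EWW: "expectation (\<lambda>\<omega>. W t \<omega> * W \<tau> \<omega>) = expectation (\<lambda>\<omega>. X t \<omega> * X \<tau> \<omega>) - m\<^sup>2" for t \<tau>
    unfolding WW by (simp add: prob_space)
  have "(1 / real n * (\<Sum>t = 1..n. X (int t) \<omega>) - a)\<^sup>2
      = (\<Sum>t = 1..n. \<Sum>\<tau> = 1..n. W (int t) \<omega> * W (int \<tau>) \<omega>) / (real n)\<^sup>2
        + 2 * (m - a) / real n * (\<Sum>t = 1..n. W (int t) \<omega>) + (m - a)\<^sup>2" for \<omega>
  proof -
    have "(\<Sum>t = 1..n. X (int t) \<omega>) = (\<Sum>t = 1..n. W (int t) \<omega>) + real n * m"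
      by (simp add: W_def sum_subtractf)
    then have "1 / real n * (\<Sum>t = 1..n. X (int t) \<omega>) - a = (\<Sum>t = 1..n. W (int t) \<omega>) / real n + (m - a)"
      using n by (simp add: field_simps)
    moreover have "(\<Sum>t = 1..n. \<Sum>\<tau> = 1..n. W (int t) \<omega> * W (int \<tau>) \<omega>) = (\<Sum>t = 1..n. W (int t) \<omega>)\<^sup>2"
      by (simp add: power2_eq_square sum_product)
    ultimately show ?thesis by (simp only: power2_sum power_divide) (simp add: mult_ac)
  qed
  then have "expectation (\<lambda>\<omega>. (1 / real n * (\<Sum>t = 1..n. X (int t) \<omega>) - a)\<^sup>2)
      = (\<Sum>t = 1..n. \<Sum>\<tau> = 1..n. expectation (\<lambda>\<omega>. W (int t) \<omega> * W (int \<tau>) \<omega>)) / (real n)\<^sup>2 + (m - a)\<^sup>2"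
    by (simp add: prob_space)
  also have "\<dots> \<le> real n * (\<phi> 0 + 2 * (\<Sum>h = 1..n. \<phi> h)) / (real n)\<^sup>2 + (m - a)\<^sup>2"
    unfolding EWW
    by (intro add_right_mono divide_right_mono
        double_sum_le_lag_sum[of "\<lambda>t \<tau>. expectation (\<lambda>\<omega>. X t \<omega> * X \<tau> \<omega>) - m\<^sup>2"] cov \<phi>) simp
  also have "real n * (\<phi> 0 + 2 * (\<Sum>h = 1..n. \<phi> h)) / (real n)\<^sup>2 = (\<phi> 0 + 2 * (\<Sum>h = 1..n. \<phi> h)) / real n"
    using n by (simp add: power2_eq_square)
  finally show ?thesis .
qed

theorem theorem3p2:
  fixes M :: "'w measure"
    and Z :: "int \<Rightarrow> 'w \<Rightarrow> real"
    and f :: "real \<Rightarrow> real"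
    and f2 :: "int \<Rightarrow> int \<Rightarrow> real \<times> real \<Rightarrow> real"
    and F :: "int \<Rightarrow> int \<Rightarrow> real \<times> real \<Rightarrow> real"
    and K :: "real \<Rightarrow> real"
    and b :: "nat \<Rightarrow> real"
    and r :: nat
    and v p\<^sub>F q\<^sub>F s D \<rho> :: real
  assumes "prob_space M"
    and "stationary M Z"
    and "two_mixing M Z v"
    and "v \<noteq> 1"
    and "\<And>t. has_density M (Z t) f"
    and "\<exists>B. \<forall>x. \<bar>f x\<bar> \<le> B"
    and "\<And>t \<tau>. t \<noteq> \<tau> \<Longrightarrow> has_density M (\<lambda>\<omega>. (Z t \<omega>, Z \<tau> \<omega>)) (f2 t \<tau>)"
    and "\<And>t \<tau> x y. t \<noteq> \<tau> \<Longrightarrow> F t \<tau> (x, y) = f2 t \<tau> (x, y) - f x * f y"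
    and "p\<^sub>F > 2"
    and "\<exists>C. \<forall>t. t \<noteq> 0 \<longrightarrow> finite_Lp p\<^sub>F (F 0 t) \<and> Lp_norm p\<^sub>F (F 0 t) \<le> C"
    and "q\<^sub>F = 1 - 2 / p\<^sub>F"
    and "kernel_of_order r K"
    and "\<exists>B. \<forall>u. \<bar>K u\<bar> \<le> B"
    and "finite_Lp 1 K"
    and "finite_Lp 2 K"
    and "s > 0" and "D > 0"
    and "f \<in> smooth_class s D"
    and "\<rho> = min (real r) s"
    and "\<And>T. b T > 0"
  shows "\<forall>z. (\<lambda>T. \<integral>\<omega>. \<bar>density_estimator Z K (b T) T z \<omega> - f z\<bar> ^ 2 \<partial>M)
    \<in> O[at_top](\<lambda>T. b T powr (2 * \<rho>) + b T powr (- 1) * real T powr (- 1)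
          + b T powr (- 2 - q\<^sub>F * (1 - max v 1)) * real T powr (- min v 1))"
proof
  fix z :: real
  interpret prob_space M by fact
  note [measurable] = \<open>stationary M Z\<close>[unfolded stationary_def, THEN conjunct1, rule_format]
  have f: "has_density M (Z t) f" for t by fact
  obtain B\<^sub>f where B\<^sub>f: "\<And>x. \<bar>f x\<bar> \<le> B\<^sub>f" using \<open>\<exists>B. \<forall>x. \<bar>f x\<bar> \<le> B\<close> by blast
  obtain B\<^sub>K where B\<^sub>K: "\<And>u. \<bar>K u\<bar> \<le> B\<^sub>K" using \<open>\<exists>B. \<forall>u. \<bar>K u\<bar> \<le> B\<close> by blast
  obtain N where N: "\<And>h. h \<noteq> 0 \<Longrightarrow> finite_Lp p\<^sub>F (F 0 h)" "\<And>h. h \<noteq> 0 \<Longrightarrow> Lp_norm p\<^sub>F (F 0 h) \<le> N"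
    using \<open>\<exists>C. \<forall>t. t \<noteq> 0 \<longrightarrow> finite_Lp p\<^sub>F (F 0 t) \<and> Lp_norm p\<^sub>F (F 0 t) \<le> C\<close> by blast
  have K: "integrable lborel K" "integrable lborel (\<lambda>u. (K u)\<^sup>2)"
    using \<open>kernel_of_order r K\<close> \<open>finite_Lp 2 K\<close>
    by (auto simp: kernel_of_order_def has_bochner_integral_iff finite_Lp_def)
  have [measurable]: "K \<in> borel_measurable borel" using K(1) borel_measurable_integrable by fastforce
  have f_meas [measurable]: "f \<in> borel_measurable borel"
    using f[of 0] by (auto simp: has_density_def dest!: distributed_real_measurable[rotated])
  have q: "0 < q\<^sub>F" using \<open>q\<^sub>F = 1 - 2 / p\<^sub>F\<close> \<open>p\<^sub>F > 2\<close> by simp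

  (* The constants are all fixed before T and the bandwidth b T: C\<^sub>b for the bias, A\<^sub>m and A\<^sub>d
     for covariances bounded by mixing and by the joint density, C\<^sub>s for sums over lags, A\<^sub>0 for
     the lag 0. *)
  obtain C\<^sub>b where C\<^sub>b: "0 \<le> C\<^sub>b" "\<And>b. 0 < b \<Longrightarrow>
      \<bar>(\<integral>x. f x * scaled_kernel K b (x - z) \<partial>lborel) - f z\<bar> \<le> C\<^sub>b * b powr \<rho>"
    using smoothing_bias_bound[where z = z, OF \<open>kernel_of_order r K\<close> B\<^sub>f f_meas \<open>f \<in> smooth_class s D\<close> \<open>s > 0\<close>]
      \<open>\<rho> = min (real r) s\<close> by blast
  obtain A\<^sub>m where A\<^sub>m: "0 \<le> A\<^sub>m" "\<And>b t \<tau>. 0 < b \<Longrightarrow> t \<noteq> \<tau> \<Longrightarrow>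
      \<bar>expectation (\<lambda>\<omega>. scaled_kernel K b (Z t \<omega> - z) * scaled_kernel K b (Z \<tau> \<omega> - z))
        - expectation (\<lambda>\<omega>. scaled_kernel K b (Z t \<omega> - z)) * expectation (\<lambda>\<omega>. scaled_kernel K b (Z \<tau> \<omega> - z))\<bar>
      \<le> A\<^sub>m * (b powr (- 2) * real_of_int \<bar>t - \<tau>\<bar> powr (- v))"
    using window_covariance_mixing_bound[where K = K and z = z, OF _ \<open>two_mixing M Z v\<close> _ B\<^sub>K] by force
  obtain C\<^sub>s where C\<^sub>s: "0 \<le> C\<^sub>s" "\<And>b n \<phi>. 0 < b \<Longrightarrow> 0 < n \<Longrightarrow>
      (\<And>h. h \<in> {1..n} \<Longrightarrow> \<phi> h \<le> b powr (q\<^sub>F - 1) \<and> \<phi> h \<le> b powr (- 2) * real h powr (- v)) \<Longrightarrow>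
      (\<Sum>h = 1..n. \<phi> h) / real n \<le> C\<^sub>s * (b powr (- 1) * real n powr (- 1)
          + b powr (- 2 - q\<^sub>F * (1 - max v 1)) * real n powr (- min v 1))"
    using sum_two_bounds[OF \<open>v \<noteq> 1\<close> q] by metis
  define A\<^sub>d where "A\<^sub>d = (\<integral>u. \<bar>K u\<bar> \<partial>lborel)\<^sup>2 + B\<^sub>K\<^sup>2 * N powr p\<^sub>F"
  define A\<^sub>0 where "A\<^sub>0 = B\<^sub>f * (\<integral>u. (K u)\<^sup>2 \<partial>lborel)"
  have A\<^sub>0: "0 \<le> A\<^sub>0" unfolding A\<^sub>0_def
    using order_trans[OF abs_ge_zero B\<^sub>f] by (intro mult_nonneg_nonneg integral_nonneg_AE) auto
  define A where "A = max A\<^sub>m A\<^sub>d"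
  have A: "0 \<le> A" "A\<^sub>m \<le> A" "A\<^sub>d \<le> A" using A\<^sub>m(1) by (auto simp: A_def)
  define E where "E T = b T powr (2 * \<rho>) + b T powr (- 1) * real T powr (- 1)
          + b T powr (- 2 - q\<^sub>F * (1 - max v 1)) * real T powr (- min v 1)" for T
  have "(\<integral>\<omega>. \<bar>density_estimator Z K (b T) T z \<omega> - f z\<bar> ^ 2 \<partial>M) \<le> (A\<^sub>0 + 2 * A * C\<^sub>s + C\<^sub>b\<^sup>2) * E T"
    if T: "0 < T" for T
  proof -
    define \<beta> where "\<beta> = b T"
    have \<beta>: "0 < \<beta>" using \<open>b T > 0\<close> by (simp add: \<beta>_def)
    define k where "k x = scaled_kernel K \<beta> (x - z)" for x
    have k_meas [measurable]: "k \<in> borel_measurable borel" unfolding k_def scaled_kernel_def by measurable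
    define m where "m = (\<integral>x. f x * k x \<partial>lborel)"
    define \<psi> where "\<psi> h = min (\<beta> powr (q\<^sub>F - 1)) (\<beta> powr (- 2) * real h powr (- v))" for h
    define \<phi> where "\<phi> h = (if h = 0 then A\<^sub>0 * \<beta> powr (- 1) else A * \<psi> h)" for h
    have mean: "expectation (\<lambda>\<omega>. k (Z t \<omega>)) = m" for t
      unfolding m_def using f[of t] by (intro distributed_integral[symmetric]) (auto simp: has_density_def)
    have joint: "expectation (\<lambda>\<omega>. k (Z 0 \<omega>) * k (Z h \<omega>)) - m\<^sup>2 \<le> A\<^sub>d * \<beta> powr (q\<^sub>F - 1)" if h: "h \<noteq> 0" for h
    proof -
      have "- 2 / p\<^sub>F = q\<^sub>F - 1" using \<open>q\<^sub>F = 1 - 2 / p\<^sub>F\<close> by simp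
      moreover have "\<bar>expectation (\<lambda>\<omega>. k (Z 0 \<omega>) * k (Z h \<omega>)) -
          expectation (\<lambda>\<omega>. k (Z 0 \<omega>)) * expectation (\<lambda>\<omega>. k (Z h \<omega>))\<bar> \<le> A\<^sub>d * \<beta> powr (- 2 / p\<^sub>F)"
        unfolding k_def A\<^sub>d_def
      proof (rule window_covariance_density_bound[OF f f _ _ N(1)[OF h] N(2)[OF h] _ K(1) B\<^sub>K \<beta>])
        show "has_density M (\<lambda>\<omega>. (Z 0 \<omega>, Z h \<omega>)) (f2 0 h)" using h assms(7) by simp
        show "F 0 h (x, y) = f2 0 h (x, y) - f x * f y" for x y using h assms(8) by simp
      qed (use \<open>p\<^sub>F > 2\<close> in simp)
      ultimately show ?thesis by (simp add: mean power2_eq_square abs_le_iff)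
    qed
    have cov: "expectation (\<lambda>\<omega>. k (Z t \<omega>) * k (Z \<tau> \<omega>)) - m\<^sup>2 \<le> \<phi> (nat \<bar>t - \<tau>\<bar>)" for t \<tau>
    proof (cases "t = \<tau>")
      case True
      have "expectation (\<lambda>\<omega>. (k (Z t \<omega>))\<^sup>2) \<le> A\<^sub>0 * \<beta> powr (- 1)"
        unfolding k_def A\<^sub>0_def by (rule second_moment_bound[OF f B\<^sub>f _ K(2) \<beta>]) simp
      moreover have "0 \<le> m\<^sup>2" by simp
      ultimately have "expectation (\<lambda>\<omega>. (k (Z t \<omega>))\<^sup>2) - m\<^sup>2 \<le> A\<^sub>0 * \<beta> powr (- 1)" by linarith
      then show ?thesis using True by (simp add: \<phi>_def power2_eq_square)
    next
      case False
      let ?c = "expectation (\<lambda>\<omega>. k (Z t \<omega>) * k (Z \<tau> \<omega>)) - m\<^sup>2"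
      have "\<bar>?c\<bar> \<le> A\<^sub>m * (\<beta> powr (- 2) * real_of_int \<bar>t - \<tau>\<bar> powr (- v))"
        using A\<^sub>m(2)[OF \<beta> False] by (simp only: k_def[symmetric] mean power2_eq_square)
      also have "\<dots> \<le> A * (\<beta> powr (- 2) * real_of_int \<bar>t - \<tau>\<bar> powr (- v))"
        using A(2) by (intro mult_right_mono) auto
      finally have 1: "?c \<le> A * (\<beta> powr (- 2) * real (nat \<bar>t - \<tau>\<bar>) powr (- v))" by simp
      have "?c \<le> A\<^sub>d * \<beta> powr (q\<^sub>F - 1)"
        using joint[of "\<tau> - t"] False stationary_pair_expectation[OF \<open>stationary M Z\<close> k_meas, of t \<tau>] by simp
      also have "\<dots> \<le> A * \<beta> powr (q\<^sub>F - 1)" using A(3) by (intro mult_right_mono) auto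
      finally have "?c \<le> A * \<psi> (nat \<bar>t - \<tau>\<bar>)" using 1 by (auto simp: \<psi>_def min_def)
      then show ?thesis using False by (simp add: \<phi>_def)
    qed
    have "(\<integral>\<omega>. \<bar>density_estimator Z K \<beta> T z \<omega> - f z\<bar> ^ 2 \<partial>M)
        = expectation (\<lambda>\<omega>. (1 / real T * (\<Sum>t = 1..T. k (Z (int t) \<omega>)) - f z)\<^sup>2)"
      by (simp add: density_estimator_def k_def)
    also have "\<dots> \<le> (\<phi> 0 + 2 * (\<Sum>h = 1..T. \<phi> h)) / real T + (m - f z)\<^sup>2"
    proof (rule sample_mean_mse_bound[where X = "\<lambda>t \<omega>. k (Z t \<omega>)", OF _ _ mean cov _ T])
      show "\<bar>k (Z t \<omega>)\<bar> \<le> B\<^sub>K / \<beta>" for t \<omega>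
        using B\<^sub>K \<beta> by (simp add: k_def scaled_kernel_def divide_right_mono)
      show "0 \<le> \<phi> h" for h using A\<^sub>0 A by (simp add: \<phi>_def \<psi>_def)
    qed simp
    also have "(\<Sum>h = 1..T. \<phi> h) = A * (\<Sum>h = 1..T. \<psi> h)"
      by (simp add: sum_distrib_left \<phi>_def)
    also have "(\<phi> 0 + 2 * (A * (\<Sum>h = 1..T. \<psi> h))) / real T
        = A\<^sub>0 * (\<beta> powr (- 1) * real T powr (- 1)) + 2 * A * ((\<Sum>h = 1..T. \<psi> h) / real T)"
      using T by (simp add: \<phi>_def powr_minus_divide add_divide_distrib)
    also have "\<dots> + (m - f z)\<^sup>2 \<le> A\<^sub>0 * E T + 2 * A * (C\<^sub>s * E T) + C\<^sub>b\<^sup>2 * E T"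
    proof (intro add_mono mult_left_mono)
      have "(\<Sum>h = 1..T. \<psi> h) / real T \<le> C\<^sub>s * (\<beta> powr (- 1) * real T powr (- 1)
          + \<beta> powr (- 2 - q\<^sub>F * (1 - max v 1)) * real T powr (- min v 1))"
        by (rule C\<^sub>s(2)[OF \<beta> T]) (simp add: \<psi>_def)
      also have "\<dots> \<le> C\<^sub>s * E T" using C\<^sub>s(1) by (intro mult_left_mono) (auto simp: E_def \<beta>_def)
      finally show "(\<Sum>h = 1..T. \<psi> h) / real T \<le> C\<^sub>s * E T" .
      have "\<bar>m - f z\<bar> \<le> C\<^sub>b * \<beta> powr \<rho>" using C\<^sub>b(2)[OF \<beta>] by (simp add: m_def k_def)
      then have "(m - f z)\<^sup>2 \<le> (C\<^sub>b * \<beta> powr \<rho>)\<^sup>2" by (metis abs_ge_zero power2_abs power_mono)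
      also have "\<dots> = C\<^sub>b\<^sup>2 * \<beta> powr (2 * \<rho>)"
        by (simp add: power_mult_distrib power2_eq_square powr_add[symmetric])
      also have "\<dots> \<le> C\<^sub>b\<^sup>2 * E T" by (intro mult_left_mono) (auto simp: E_def \<beta>_def)
      finally show "(m - f z)\<^sup>2 \<le> C\<^sub>b\<^sup>2 * E T" .
    qed (use A\<^sub>0 A in \<open>auto simp: E_def \<beta>_def\<close>)
    also have "\<dots> = (A\<^sub>0 + 2 * A * C\<^sub>s + C\<^sub>b\<^sup>2) * E T" by (simp add: algebra_simps)
    finally show ?thesis by (simp add: \<beta>_def)
  qed
  then have "(\<lambda>T. \<integral>\<omega>. \<bar>density_estimator Z K (b T) T z \<omega> - f z\<bar> ^ 2 \<partial>M) \<in> O[at_top](E)"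
    by (intro bigoI[where c = "A\<^sub>0 + 2 * A * C\<^sub>s + C\<^sub>b\<^sup>2"] eventually_mono[OF eventually_gt_at_top[of 0]])
      (auto simp: E_def)
  then show "(\<lambda>T. \<integral>\<omega>. \<bar>density_estimator Z K (b T) T z \<omega> - f z\<bar> ^ 2 \<partial>M)
    \<in> O[at_top](\<lambda>T. b T powr (2 * \<rho>) + b T powr (- 1) * real T powr (- 1)
          + b T powr (- 2 - q\<^sub>F * (1 - max v 1)) * real T powr (- min v 1))"
    unfolding E_def .
qed

end
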